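(* Let $\{P_\theta:\theta\in\Theta\}$ be a regular 1-dimensional exponential family given in its mean-value parameterization and extended to $n$ outcomes by independence, and let $\Theta^\circ$ be an arbitrary compact subinterval of $\Theta$. Consider the restricted model $\{P_\theta:\theta\in\Theta^\circ\}$ and, for sample size $n$ and anticipated sample size $n^*>0$, the collection $\{S_\theta:\theta\in\Theta^\circ\}$ given by $$S_\theta(x^n)=\frac{\tfrac12 p_{\theta^-}(x^n)+\tfrac12 p_{\theta^+}(x^n)}{p_\theta(x^n)},$$ where $\theta^-<\theta<\theta^+$ are defined by $D(\theta\|\theta^+)=D(\theta\|\theta^-)=1/n^*$. Let $\bar P(\theta\mid x^n)=1/S_\theta(x^n)$ and $L(\theta,\breve\theta)=2D(\breve\theta\|\theta)$, and let $$\kappa:=\max_{x\in\mathbb{R}}\frac{x^2}{e^x+e^{-x}}=0.53\ldots$$ Then for every $0<c\le 1$ there is a constant $C^*$ such that for all $n$ and all $n^*$ with $c\le n^*/n\le 1/c$, uniformly for all $x^n$ with $\hat\theta(x^n)\in\Theta^\circ$, $$\max_{\theta\in\Theta^\circ}L(\theta,\hat\theta(x^n))\cdot\bar P(\theta\mid x^n)=\frac1n\cdot\frac{n^*}{n}\cdot e^{n/n^*}\cdot f_n\cdot\kappa,$$ where $1-\sqrt{C^*/n}\le f_n\le 1+\sqrt{C^*/n}$. In particular, if $n^*=n$, the right-hand side equals $\frac1n\cdot f_n\cdot e\kappa$, with $e\kappa\approx 1.45$.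
   Context: A regular 1-dimensional exponential family is a (nondegenerate) family with densities $p_\beta(x)=\exp(\beta\phi(x)-\psi(\beta))$ relative to a common underlying measure, with real sufficient statistic $\phi$, whose canonical parameter space is the full natural parameter space $\{\beta:\psi(\beta)<\infty\}$ and is open. In the mean-value parameterization, $\theta=\mathbf{E}_{X\sim P_\theta}[\phi(X)]$, and $\Theta\subset\mathbb{R}$ is the (open interval) set of all such means. For $x^n=(x_1,\dots,x_n)$, $p_\theta(x^n)=\prod_{i=1}^n p_\theta(x_i)$. $D(\theta'\|\theta)$ denotes the Kullback-Leibler divergence from $P_{\theta'}$ to $P_\theta$ on a single outcome, i.e. $\mathbf{E}_{X\sim P_{\theta'}}[\log(p_{\theta'}(X)/p_\theta(X))]$. $\hat\theta(x^n)$ is the maximum likelihood estimator, which is unique and equal to $n^{-1}\sum_{i=1}^n\phi(x_i)$ whenever this average lies in $\Theta$. For every $\theta\in\Theta$ and $n^*>0$ there exist $\theta^-<\theta<\theta^+$ in $\Theta$ with $D(\theta\|\theta^\pm)=1/n^*$. The factor $f_n$ may depend on $x^n$ and $n^*$, but $C^*$ depends only on $c$, the family and $\Theta^\circ$. A compact subinterval is understood to have nonempty interior. *)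

theory Defs
  imports "HOL-Probability.Probability"
begin

text \<open>
  \<^term>\<open>M\<close> is the common underlying measure and \<^term>\<open>\<phi>\<close> the sufficient statistic; a carrier density
  is absorbed into \<^term>\<open>M\<close>. For measurable \<^term>\<open>\<phi>\<close> integrability of the (nonnegative) function below
  is the condition that the log-partition function is finite.
\<close>

definition natural_space :: "'a measure \<Rightarrow> ('a \<Rightarrow> real) \<Rightarrow> real set" where
  "natural_space M \<phi> = {\<beta>. integrable M (\<lambda>x. exp (\<beta> * \<phi> x))}"

definition log_partition :: "'a measure \<Rightarrow> ('a \<Rightarrow> real) \<Rightarrow> real \<Rightarrow> real" where
  "log_partition M \<phi> \<beta> = ln (\<integral>x. exp (\<beta> * \<phi> x) \<partial>M)"

definition canonical_density :: "'a measure \<Rightarrow> ('a \<Rightarrow> real) \<Rightarrow> real \<Rightarrow> 'a \<Rightarrow> real" where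
  "canonical_density M \<phi> \<beta> x = exp (\<beta> * \<phi> x - log_partition M \<phi> \<beta>)"

definition canonical_measure :: "'a measure \<Rightarrow> ('a \<Rightarrow> real) \<Rightarrow> real \<Rightarrow> 'a measure" where
  "canonical_measure M \<phi> \<beta> = density M (\<lambda>x. ennreal (canonical_density M \<phi> \<beta> x))"

text \<open>
  Sigma-finiteness of \<^term>\<open>M\<close> need not be assumed: it follows from the integrability of a strictly
  positive function.
\<close>

definition regular_exp_family :: "'a measure \<Rightarrow> ('a \<Rightarrow> real) \<Rightarrow> bool" where
  "regular_exp_family M \<phi> \<longleftrightarrow>
     \<phi> \<in> borel_measurable M \<and>
     \<not> (\<exists>k. AE x in M. \<phi> x = k) \<and>
     natural_space M \<phi> \<noteq> {} \<and> open (natural_space M \<phi>)"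

definition mean_value :: "'a measure \<Rightarrow> ('a \<Rightarrow> real) \<Rightarrow> real \<Rightarrow> real" where
  "mean_value M \<phi> \<beta> = (\<integral>x. \<phi> x \<partial>canonical_measure M \<phi> \<beta>)"

definition mean_space :: "'a measure \<Rightarrow> ('a \<Rightarrow> real) \<Rightarrow> real set" where
  "mean_space M \<phi> = mean_value M \<phi> ` natural_space M \<phi>"

text \<open>
  For a regular family \<^term>\<open>mean_value M \<phi>\<close> is injective on the natural parameter space, so the
  mean-value parameterization is obtained by inverting it.
\<close>

definition canonical_param :: "'a measure \<Rightarrow> ('a \<Rightarrow> real) \<Rightarrow> real \<Rightarrow> real" where
  "canonical_param M \<phi> \<theta> = the_inv_into (natural_space M \<phi>) (mean_value M \<phi>) \<theta>"

definition mv_density :: "'a measure \<Rightarrow> ('a \<Rightarrow> real) \<Rightarrow> real \<Rightarrow> 'a \<Rightarrow> real" where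
  "mv_density M \<phi> \<theta> = canonical_density M \<phi> (canonical_param M \<phi> \<theta>)"

definition mv_measure :: "'a measure \<Rightarrow> ('a \<Rightarrow> real) \<Rightarrow> real \<Rightarrow> 'a measure" where
  "mv_measure M \<phi> \<theta> = density M (\<lambda>x. ennreal (mv_density M \<phi> \<theta> x))"

definition seq_density :: "'a measure \<Rightarrow> ('a \<Rightarrow> real) \<Rightarrow> nat \<Rightarrow> real \<Rightarrow> (nat \<Rightarrow> 'a) \<Rightarrow> real" where
  "seq_density M \<phi> n \<theta> xs = (\<Prod>i<n. mv_density M \<phi> \<theta> (xs i))"

text \<open>
  \<^term>\<open>fam_KL M \<phi> \<theta>' \<theta>\<close> is the divergence \<open>D(\<theta>' \<parallel> \<theta>)\<close> in nats, with expectation under \<^term>\<open>\<theta>'\<close>.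
  Note the argument order of the library constant: \<^term>\<open>KL_divergence b N K\<close> integrates
  over its last argument \<^term>\<open>K\<close>.
\<close>

definition fam_KL :: "'a measure \<Rightarrow> ('a \<Rightarrow> real) \<Rightarrow> real \<Rightarrow> real \<Rightarrow> real" where
  "fam_KL M \<phi> \<theta>' \<theta> = KL_divergence (exp 1) (mv_measure M \<phi> \<theta>) (mv_measure M \<phi> \<theta>')"

text \<open>The maximum likelihood estimator ranges over the full parameter space.\<close>

definition is_mle :: "'a measure \<Rightarrow> ('a \<Rightarrow> real) \<Rightarrow> nat \<Rightarrow> (nat \<Rightarrow> 'a) \<Rightarrow> real \<Rightarrow> bool" where
  "is_mle M \<phi> n xs \<theta> \<longleftrightarrow>
     is_arg_max (\<lambda>t. seq_density M \<phi> n t xs) (\<lambda>t. t \<in> mean_space M \<phi>) \<theta>"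

definition theta_minus :: "'a measure \<Rightarrow> ('a \<Rightarrow> real) \<Rightarrow> real \<Rightarrow> real \<Rightarrow> real" where
  "theta_minus M \<phi> nstar \<theta> =
     (THE t. t \<in> mean_space M \<phi> \<and> t < \<theta> \<and> fam_KL M \<phi> \<theta> t = 1 / nstar)"

definition theta_plus :: "'a measure \<Rightarrow> ('a \<Rightarrow> real) \<Rightarrow> real \<Rightarrow> real \<Rightarrow> real" where
  "theta_plus M \<phi> nstar \<theta> =
     (THE t. t \<in> mean_space M \<phi> \<and> \<theta> < t \<and> fam_KL M \<phi> \<theta> t = 1 / nstar)"

definition S_stat ::
  "'a measure \<Rightarrow> ('a \<Rightarrow> real) \<Rightarrow> nat \<Rightarrow> real \<Rightarrow> real \<Rightarrow> (nat \<Rightarrow> 'a) \<Rightarrow> real" where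
  "S_stat M \<phi> n nstar \<theta> xs =
     (1/2 * seq_density M \<phi> n (theta_minus M \<phi> nstar \<theta>) xs
      + 1/2 * seq_density M \<phi> n (theta_plus M \<phi> nstar \<theta>) xs)
     / seq_density M \<phi> n \<theta> xs"

definition P_bar ::
  "'a measure \<Rightarrow> ('a \<Rightarrow> real) \<Rightarrow> nat \<Rightarrow> real \<Rightarrow> real \<Rightarrow> (nat \<Rightarrow> 'a) \<Rightarrow> real" where
  "P_bar M \<phi> n nstar \<theta> xs = 1 / S_stat M \<phi> n nstar \<theta> xs"

definition loss :: "'a measure \<Rightarrow> ('a \<Rightarrow> real) \<Rightarrow> real \<Rightarrow> real \<Rightarrow> real" where
  "loss M \<phi> \<theta> \<theta>' = 2 * fam_KL M \<phi> \<theta>' \<theta>"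

definition is_maximum :: "('b \<Rightarrow> real) \<Rightarrow> 'b set \<Rightarrow> real \<Rightarrow> bool" where
  "is_maximum f A m \<longleftrightarrow> m \<in> f ` A \<and> (\<forall>x\<in>A. f x \<le> m)"

definition kappa :: real where
  "kappa = (THE m. is_maximum (\<lambda>x::real. x\<^sup>2 / (exp x + exp (- x))) UNIV m)"

end

theory Submission
  imports Defs
begin

text \<open>
  In canonical coordinates the divergence \<open>D(\<theta>' \<parallel> \<theta>)\<close> is the Bregman divergence of the log-partition
  function \<open>A\<close>, so the theorem is a statement about one strictly convex function, isolated in the
  locale \<open>regular_cumulant\<close>. Let \<open>b\<close>, \<open>bh\<close> and \<open>t\<^sup>\<plusminus>\<close> be the canonical parameters of \<open>\<theta>\<close>, of the estimate
  and of \<open>\<theta>\<^sup>\<plusminus>\<close>, and put \<open>K = 1/n*\<close>. Since the estimate is the sample mean, the log-likelihood ratios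
  in \<open>S\<^sub>\<theta>\<close> are \<open>E\<^sup>\<plusminus> - n K\<close>, where \<open>E\<^sup>\<plusminus>\<close> is \<open>n\<close> times \<open>t\<^sup>\<plusminus> - b\<close> times the difference of the means at
  \<open>bh\<close> and \<open>b\<close>. Multiplied by \<open>n\<^sup>2 K exp (- n K)\<close>, the product of loss and posterior therefore equals
  \<open>x\<^sup>2 / (exp E\<^sup>+ + exp E\<^sup>-)\<close> with \<open>x = 2 n sqrt (K D)\<close>, \<open>D\<close> being the divergence from the estimate to
  \<open>\<theta>\<close> (\<open>objective_eq_perturbed_hump\<close>).

  If \<open>A''\<close> were constant, the exponents would be exactly \<open>x\<close> and \<open>- x\<close>, and the maximum over \<open>x\<close> would
  be \<open>kappa\<close>. In general the mean value theorem gives \<open>(E\<^sup>\<plusminus>)\<^sup>2 = x\<^sup>2 A''(\<xi>\<^sub>3)\<^sup>2 / (A''(\<xi>\<^sub>1) A''(\<xi>\<^sub>2))\<close>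
  with intermediate points \<open>\<xi>\<^sub>i\<close> (\<open>expo_square\<close>). As \<open>A''\<close> is positive and Lipschitz on compact sets, this
  identity controls both exponents. While \<open>x\<close> is bounded, all points involved are within \<open>O(1 / sqrt n)\<close> of
  each other and the value is that of the extremal function up to a factor
  \<open>1 + O(1 / sqrt n)\<close> (\<open>objective_near\<close>). For large \<open>x\<close> the positive exponent is at least a fixed
  multiple of \<open>x\<close> and the value is below \<open>kappa\<close> (\<open>objective_far\<close>). The maximizer of the extremal
  function is a value of \<open>x\<close> on the parameter interval once \<open>n\<close> is large (\<open>radius_attained\<close>). Bounded
  \<open>n\<close> is absorbed into the constant.

  That the maximum exists needs continuity of \<open>t\<^sup>\<plusminus>\<close> in \<open>b\<close> (\<open>cont_reach\<close>), and that \<open>t\<^sup>\<plusminus>\<close> exists at all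
  needs the divergence to be unbounded in both directions (\<open>breg_unbounded\<close>); this is where regularity
  of the family enters, through Fatou's lemma (\<open>log_partition_proper\<close>). The three derivatives of \<open>A\<close>
  come from differentiation under the integral sign (\<open>deriv_moment\<close>).
\<close>

section \<open>The constant kappa\<close>

definition hump :: "real \<Rightarrow> real" where
  "hump x = x\<^sup>2 / (exp x + exp (- x))"

lemma exp_plus_exp_minus_pos: "0 < exp x + exp (- x :: real)"
  by (simp add: add_pos_pos)

lemma hump_nonneg: "0 \<le> hump x"
  by (simp add: hump_def add_nonneg_nonneg)

lemma hump_abs: "hump \<bar>x\<bar> = hump x"
  by (cases "0 \<le> x") (simp_all add: hump_def add.commute)

lemma exp_plus_exp_minus_ge_Taylor:
  fixes x :: real
  shows "2 + x^2 + x^4 / 12 + x^6 / 360 \<le> exp x + exp (- x)"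
proof -
  let ?a = "\<lambda>n. if even n then x ^ n /\<^sub>R fact n else 0"
  have s: "?a sums cosh x"
    using cosh_converges[of x] .
  have "sum ?a {..<7} \<le> cosh x"
    using sum_le_suminf[OF sums_summable[OF s], of "{..<7}"] sums_unique[OF s]
    by (auto simp: zero_le_even_power)
  moreover have "sum ?a {..<7} = 1 + x^2 / 2 + x^4 / 24 + x^6 / 720"
  proof -
    have "{..<7} = {0, 1, 2, 3, 4, 5, 6 :: nat}" by auto
    then show ?thesis by (simp add: fact_numeral)
  qed
  ultimately show ?thesis
    unfolding cosh_def by (simp add: field_simps)
qed

text \<open>
  The sextic Taylor bound turns the claim into positivity, for \<open>y = x\<^sup>2\<close>, of a cubic whose minimum
  over \<open>y \<ge> 0\<close> lies near \<open>4.3\<close> and has the small value \<open>0.013\<close>; this is sharp enough for two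
  digits of the maximum.
\<close>

lemma hump_le: "hump x \<le> 0.535"
proof -
  have cubic: "y \<le> 0.535 * (2 + y + y^2 / 12 + y^3 / 360)" if "0 \<le> y" for y :: real
  proof -
    \<comment> \<open>Bounding \<open>y\<^sup>3\<close> by means of \<open>y (y - 17/4)\<^sup>2 \<ge> 0\<close>, with double root close to the minimum, leaves
      a quadratic; its square term is bounded by the tangent at \<open>43/10\<close>.\<close>
    have "0 \<le> y * (y - 17/4)^2" using that by simp
    then have c: "y^3 \<ge> 17/2 * y^2 - 289/16 * y"
      by (simp add: power2_eq_square power3_eq_cube algebra_simps)
    have "0 \<le> (y - 43/10)^2" by simp
    then have q: "y^2 \<ge> 43/5 * y - 1849/100"
      by (simp add: power2_eq_square algebra_simps)
    show ?thesis using c q that by simp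
  qed
  have "x\<^sup>2 \<le> 0.535 * (2 + x^2 + x^4 / 12 + x^6 / 360)"
    using cubic[of "x\<^sup>2"] by (simp add: power_mult[symmetric])
  also have "\<dots> \<le> 0.535 * (exp x + exp (- x))"
    using exp_plus_exp_minus_ge_Taylor[of x] by simp
  finally show ?thesis
    unfolding hump_def using exp_plus_exp_minus_pos[of x] by (simp add: divide_le_eq)
qed

lemma hump_tail: "hump x \<le> 12 / x\<^sup>2" if "x \<noteq> 0"
proof -
  have "0 \<le> x^6" by (rule zero_le_even_power) simp
  then have "x^4 / 12 \<le> exp x + exp (- x)"
    using exp_plus_exp_minus_ge_Taylor[of x] zero_le_power2[of x] by linarith
  then have "hump x \<le> x\<^sup>2 / (x^4 / 12)"
    unfolding hump_def using that by (intro divide_left_mono) (auto simp: add_pos_pos)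
  also have "\<dots> = 12 / x\<^sup>2" using that by (simp add: field_simps power2_eq_square power4_eq_xxxx)
  finally show ?thesis .
qed

lemma exp_1_bounds: "2.7182 < exp (1::real)" "exp (1::real) < 2.7183"
  using e_approx_32 unfolding abs_le_iff by (simp_all add: field_simps)

text \<open>The maximizer is near \<open>2.07\<close>, and \<^const>\<open>hump\<close> is flat enough there for \<open>2\<close> to be a good test point.\<close>

lemma hump_2: "1.445 \<le> exp 1 * hump 2"
proof -
  define e :: real where "e = exp 1"
  have e: "2.7182 < e" "e < 2.7183" using exp_1_bounds by (auto simp: e_def)
  have e4: "e ^ 4 > 54.59"
    using power_strict_mono[of "2.7182" e 4] e by (simp add: power4_eq_xxxx)
  have 2: "exp 2 = e\<^sup>2" by (simp add: e_def exp_double[symmetric])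
  have "exp 1 * hump 2 = 4 * e / (e\<^sup>2 + 1 / e\<^sup>2)"
    by (simp add: hump_def 2 exp_minus inverse_eq_divide e_def)
  also have "\<dots> = 4 / (e * (1 + 1 / e ^ 4))"
    using e by (simp add: divide_simps power2_eq_square power4_eq_xxxx)
  finally have eq: "exp 1 * hump 2 = 4 / (e * (1 + 1 / e ^ 4))" .
  have "1 / e ^ 4 \<le> 1 / 54.59" using e4 by (intro divide_left_mono) auto
  then have "e * (1 + 1 / e ^ 4) \<le> 2.7183 * (1 + 1 / 54.59)"
    using e by (intro mult_mono) auto
  moreover have "0 < e * (1 + 1 / e ^ 4)"
    using e e4 by (intro mult_pos_pos add_pos_pos) auto
  ultimately have "4 / (2.7183 * (1 + 1 / 54.59)) \<le> exp 1 * hump 2"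
    unfolding eq by (intro divide_left_mono) auto
  then show ?thesis by simp
qed

lemma hump_2_ge: "0.531 \<le> hump 2"
  using hump_2 exp_1_bounds mult_right_mono[of "exp 1" "2.7183" "hump 2"] hump_nonneg[of 2]
  by simp

text \<open>
  Outside \<open>[-5, 5]\<close> the tail bound keeps \<^const>\<open>hump\<close> below its value at \<open>2\<close>, so the maximum over
  the compact interval is global.
\<close>

lemma is_maximum_hump: "is_maximum hump UNIV kappa"
proof -
  have "continuous_on {-5..5} hump"
    unfolding hump_def
    by (intro continuous_intros) (metis exp_plus_exp_minus_pos less_irrefl)
  then obtain x where x: "x \<in> {-5..5}" "\<And>y. y \<in> {-5..5} \<Longrightarrow> hump y \<le> hump x"
    using continuous_attains_sup[of "{-5..5}" hump] by auto
  have "hump y \<le> hump x" for y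
  proof (cases "y \<in> {-5..5}")
    case False
    then have "5\<^sup>2 \<le> \<bar>y\<bar>\<^sup>2" by (intro power_mono) auto
    then have "hump y \<le> 12 / 25"
      using hump_tail[of y] False frac_le[of 12 12 25 "y\<^sup>2"] by fastforce
    also have "\<dots> \<le> hump 2" using hump_2_ge by simp
    also have "\<dots> \<le> hump x" by (rule x) simp
    finally show ?thesis .
  qed (use x in auto)
  then have "is_maximum hump UNIV (hump x)" by (auto simp: is_maximum_def)
  moreover have "\<And>m. is_maximum hump UNIV m \<Longrightarrow> m = hump x"
    using calculation unfolding is_maximum_def by (metis UNIV_I imageE order_antisym)
  ultimately show ?thesis
    unfolding kappa_def hump_def[symmetric, abs_def] by (rule theI)
qed

lemma hump_le_kappa: "hump x \<le> kappa"
  using is_maximum_hump by (simp add: is_maximum_def)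

lemma kappa_bounds: "0.531 \<le> kappa" "kappa \<le> 0.535" "1.445 \<le> exp 1 * kappa"
proof -
  show "0.531 \<le> kappa" using hump_2_ge hump_le_kappa[of 2] by simp
  show "kappa \<le> 0.535" using is_maximum_hump hump_le unfolding is_maximum_def by (metis imageE)
  show "1.445 \<le> exp 1 * kappa" using hump_2 hump_le_kappa[of 2]
    by (smt (verit) exp_gt_zero mult_left_mono)
qed

lemma kappa_attained: obtains x where "0 < x" "hump x = kappa"
proof -
  obtain x where x: "hump x = kappa"
    using is_maximum_hump unfolding is_maximum_def by (metis imageE)
  then have "x \<noteq> 0" using kappa_bounds by (auto simp: hump_def)
  then show ?thesis using that[of "\<bar>x\<bar>"] x hump_abs by simp
qed

section \<open>Bregman divergences of a strictly convex function that is proper at the boundary\<close>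

text \<open>
  The divergence between members of an exponential family is the Bregman divergence of the
  log-partition function \<open>A\<close>, and everything about the family that matters for the maximum is
  contained in the assumptions below. \<open>A1\<close>, \<open>A2\<close>, \<open>A3\<close> are the first three derivatives of \<open>A\<close>
  (for an exponential family: mean, variance, third central moment). The last assumption says
  that \<open>A\<close> tends to infinity at every finite boundary point of \<open>B\<close>.
\<close>

locale regular_cumulant =
  fixes B :: "real set" and A A1 A2 A3 :: "real \<Rightarrow> real"
  assumes open_B: "open B" and interval_B: "is_interval B"
    and deriv_A: "b \<in> B \<Longrightarrow> (A has_real_derivative A1 b) (at b)"
    and deriv_A1: "b \<in> B \<Longrightarrow> (A1 has_real_derivative A2 b) (at b)"
    and deriv_A2: "b \<in> B \<Longrightarrow> (A2 has_real_derivative A3 b) (at b)"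
    and cont_A3: "continuous_on B A3"
    and A2_pos: "b \<in> B \<Longrightarrow> 0 < A2 b"
    and proper: "(\<And>k. t k \<in> B) \<Longrightarrow> t \<longlonglongrightarrow> e \<Longrightarrow> (\<And>k. A (t k) \<le> K) \<Longrightarrow> e \<in> B"
begin

definition breg :: "real \<Rightarrow> real \<Rightarrow> real" where
  "breg b t = A t - A b - (t - b) * A1 b"

lemma segment_in_B: "b \<in> B \<Longrightarrow> t \<in> B \<Longrightarrow> closed_segment b t \<subseteq> B"
  using interval_B by (metis closed_segment_subset is_interval_convex_1)

lemma cont_A: "continuous_on B A"
  using deriv_A by (auto intro: continuous_at_imp_continuous_on DERIV_isCont)

lemma cont_A1: "continuous_on B A1"
  using deriv_A1 by (auto intro: continuous_at_imp_continuous_on DERIV_isCont)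

lemma cont_A2: "continuous_on B A2"
  using deriv_A2 by (auto intro: continuous_at_imp_continuous_on DERIV_isCont)

lemma A1_mvt:
  assumes "b \<in> B" "t \<in> B"
  shows "\<exists>\<xi>\<in>closed_segment b t. A1 t - A1 b = A2 \<xi> * (t - b)"
proof -
  have "\<exists>\<xi>\<in>{b..t}. A1 t - A1 b = A2 \<xi> * (t - b)"
    if lt: "b < t" and "b \<in> B" "t \<in> B" for b t
  proof -
    have "{b..t} \<subseteq> B" using segment_in_B[of b t] that by (simp add: closed_segment_eq_real_ivl)
    then have "(A1 has_real_derivative A2 x) (at x)" if "b \<le> x" "x \<le> t" for x
      using that by (intro deriv_A1) auto
    then obtain \<xi> where "b < \<xi>" "\<xi> < t" "A1 t - A1 b = (t - b) * A2 \<xi>"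
      using MVT2[OF lt, of A1 A2] by blast
    then show ?thesis by (intro bexI[of _ \<xi>]) auto
  qed
  note le = this
  show ?thesis
  proof (cases b t rule: linorder_cases)
    case less
    then show ?thesis using le[of b t] assms by (auto simp: closed_segment_eq_real_ivl)
  next
    case greater
    then obtain \<xi> where "\<xi> \<in> {t..b}" "A1 b - A1 t = A2 \<xi> * (b - t)"
      using le[of t b] assms by auto
    then show ?thesis
      using greater by (intro bexI[of _ \<xi>]) (auto simp: closed_segment_eq_real_ivl algebra_simps)
  qed auto
qed

lemma A1_strict_mono: "b \<in> B \<Longrightarrow> t \<in> B \<Longrightarrow> b < t \<Longrightarrow> A1 b < A1 t"
  using A1_mvt[of b t] A2_pos segment_in_B[of b t]
  by (smt (verit, best) mult_pos_pos subsetD)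

lemma breg_mvt:
  assumes "b \<in> B" "t \<in> B"
  shows "\<exists>\<xi>\<in>closed_segment b t. breg b t = A2 \<xi> / 2 * (t - b)\<^sup>2"
proof (cases "b = t")
  case False
  define diff where "diff m = (if m = 0 then A else if m = 1 then A1 else A2)" for m :: nat
  have sub: "{min b t..max b t} \<subseteq> B"
    using segment_in_B[OF assms] by (auto simp: closed_segment_eq_real_ivl min_def max_def split: if_splits)
  have "DERIV (diff m) x :> diff (Suc m) x"
    if "m < 2" "min b t \<le> x" "x \<le> max b t" for m x
  proof -
    have "x \<in> B" using sub that by auto
    then show ?thesis using deriv_A deriv_A1 \<open>m < 2\<close> by (auto simp: diff_def)
  qed
  then obtain \<xi> where \<xi>: "if t < b then t < \<xi> \<and> \<xi> < b else b < \<xi> \<and> \<xi> < t"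
    and eq: "A t = (\<Sum>m<2. diff m b / fact m * (t - b) ^ m) + diff 2 \<xi> / fact 2 * (t - b) ^ 2"
    using Taylor[of 2 diff A "min b t" "max b t" b t] False
    by (simp add: diff_def) blast
  have "breg b t = A2 \<xi> / 2 * (t - b)\<^sup>2"
    using eq by (simp add: breg_def diff_def numeral_2_eq_2 algebra_simps)
  then show ?thesis
    using \<xi> by (intro bexI[of _ \<xi>]) (simp_all add: closed_segment_eq_real_ivl split: if_splits)
qed (simp add: breg_def)

lemma breg_self [simp]: "breg b b = 0"
  by (simp add: breg_def)

lemma breg_pos: "b \<in> B \<Longrightarrow> t \<in> B \<Longrightarrow> b \<noteq> t \<Longrightarrow> 0 < breg b t"
  using breg_mvt[of b t] A2_pos segment_in_B[of b t]
  by (smt (verit, best) half_gt_zero mult_pos_pos subsetD zero_less_power2)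

lemma breg_nonneg: "b \<in> B \<Longrightarrow> t \<in> B \<Longrightarrow> 0 \<le> breg b t"
  using breg_pos[of b t] by (cases "b = t") auto

lemma breg_three_point:
  "breg b t' = breg b t + breg t t' + (t' - t) * (A1 t - A1 b)"
  by (simp add: breg_def algebra_simps)

text \<open>Moving away from \<open>b\<close>: the hypothesis says that \<open>t\<close> lies strictly between \<open>b\<close> and \<open>t'\<close>.\<close>

lemma breg_mono:
  assumes "b \<in> B" "t \<in> B" "t' \<in> B" and sep: "0 < (t - b) * (t' - t)"
  shows "breg b t < breg b t'"
proof -
  have "0 < (t' - t) * (A1 t - A1 b)"
    using sep A1_strict_mono[of b t] A1_strict_mono[of t b] assms(1,2)
    by (auto simp: zero_less_mult_iff)
  then show ?thesis
    using breg_three_point[of b t' t] breg_nonneg[of t t'] assms by simp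
qed

lemma cont_breg_right: "continuous_on B (breg b)"
  unfolding breg_def by (intro continuous_intros cont_A)

lemma cont_breg_left: "t \<in> B \<Longrightarrow> continuous_on B (\<lambda>b. breg b t)"
  unfolding breg_def by (intro continuous_intros cont_A cont_A1)

lemma breg_IVT:
  assumes "b \<in> B" "t \<in> B" "0 \<le> v" "v \<le> breg b t"
  obtains t' where "t' \<in> closed_segment b t" "breg b t' = v"
proof -
  have "connected (breg b ` closed_segment b t)"
    by (intro connected_continuous_image continuous_on_subset[OF cont_breg_right]
        segment_in_B assms) simp
  moreover have "0 \<in> breg b ` closed_segment b t" "breg b t \<in> breg b ` closed_segment b t"
    by (auto intro: rev_image_eqI[of b])
  ultimately have "v \<in> breg b ` closed_segment b t"
    using assms connectedD_interval by blast
  then show ?thesis using that by blast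
qed

text \<open>
  In each direction \<open>s = \<plusminus>1\<close> the divergence from \<open>b\<close> is unbounded. If it were bounded by \<open>K\<close>,
  then \<open>A\<close> would be bounded along every convergent sequence on that side, so by properness the
  part of \<open>B\<close> on that side would be closed as well as open in the half-line, hence the whole
  half-line; but along a half-line the divergence grows at least linearly.
\<close>

lemma breg_unbounded:
  assumes b: "b \<in> B" and s: "s = 1 \<or> s = -1"
  shows "\<exists>t\<in>B. 0 < s * (t - b) \<and> K \<le> breg b t"
proof (rule ccontr)
  assume "\<not> ?thesis"
  then have less: "breg b t < K" if "t \<in> B" "0 < s * (t - b)" for t
    using that by force
  define H where "H = {t. 0 \<le> s * (t - b)}"
  have H_eq: "H = {b..} \<or> H = {..b}"
    using s by (auto simp: H_def)
  then have H: "closed H" "connected H"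
    by auto
  have le: "A t \<le> \<bar>K\<bar> + A b + (t - b) * A1 b" if "t \<in> B \<inter> H" for t
  proof (cases "t = b")
    case False
    with that s have "0 < s * (t - b)" by (auto simp: H_def)
    then show ?thesis using less[of t] that by (simp add: breg_def)
  qed simp
  have "closed (B \<inter> H)"
    unfolding closed_sequential_limits
  proof (intro allI impI, elim conjE)
    fix t e assume t: "\<forall>k. t k \<in> B \<inter> H" and lim: "t \<longlonglongrightarrow> e"
    have "bounded (range (\<lambda>k. \<bar>K\<bar> + A b + (t k - b) * A1 b))"
      by (rule convergent_imp_bounded[of _ "\<bar>K\<bar> + A b + (e - b) * A1 b"])
        (intro tendsto_intros lim)
    then obtain L where L: "\<And>k. \<bar>K\<bar> + A b + (t k - b) * A1 b \<le> L"
      unfolding bounded_iff by (force simp: abs_le_iff)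
    have "A (t k) \<le> L" for k
      using le[of "t k"] t L[of k] by (meson order_trans)
    then have "e \<in> B"
      using proper[of t e L] lim t by blast
    moreover have "e \<in> H"
      using H(1) t lim unfolding closed_sequential_limits by blast
    ultimately show "e \<in> B \<inter> H" by simp
  qed
  then have "closedin (top_of_set H) (B \<inter> H)"
    by (simp add: closedin_closed_eq H)
  moreover have "openin (top_of_set H) (B \<inter> H)"
    using openin_open_Int[OF open_B, of H] by (simp add: Int_commute)
  moreover have "b \<in> B \<inter> H" using b by (simp add: H_def)
  ultimately have "B \<inter> H = H"
    using H(2) unfolding connected_clopen by blast
  then have "H \<subseteq> B" by blast
  moreover have "b + s * d \<in> H" if "0 \<le> d" for d
    using that s by (auto simp: H_def)
  ultimately have HB: "b + s * d \<in> B" if "0 \<le> d" for d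
    using that by blast
  define t where "t = b + s"
  have t: "t \<in> B" using HB[of 1] by (simp add: t_def)
  define g where "g = s * (A1 t - A1 b)"
  have g: "0 < g"
    using s A1_strict_mono[of b t] A1_strict_mono[of t b] b t by (auto simp: g_def t_def)
  define d where "d = 1 + \<bar>K\<bar> / g"
  have d: "1 \<le> d" using g by (simp add: d_def)
  have "K \<le> (d - 1) * g" using g by (simp add: d_def)
  also have "\<dots> = (b + s * d - t) * (A1 t - A1 b)"
    by (simp add: g_def t_def algebra_simps)
  also have "\<dots> \<le> breg b (b + s * d)"
    using breg_three_point[of b "b + s * d" t] breg_nonneg[OF b t] breg_nonneg[OF t HB[of d]] d
    by simp
  also have "\<dots> < K"
    using less[OF HB[of d]] d s by auto
  finally show False by simp
qed

text \<open>
  For \<open>K = 1/n*\<close> the canonical parameters of \<open>\<theta>\<^sup>+\<close> and \<open>\<theta>\<^sup>-\<close> are \<open>reach 1 K b\<close> and \<open>reach (-1) K b\<close>.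
\<close>

definition reach :: "real \<Rightarrow> real \<Rightarrow> real \<Rightarrow> real" where
  "reach s K b = (THE t. t \<in> B \<and> 0 < s * (t - b) \<and> breg b t = K)"

lemma same_side_mono:
  assumes "s = 1 \<or> s = -1" "b \<in> B" "t \<in> B" "t' \<in> B" "0 < s * (t - b)" "s * t < s * t'"
  shows "breg b t < breg b t'"
  using assms by (intro breg_mono) (auto simp: zero_less_mult_iff)

lemma reach_ex1:
  assumes s: "s = 1 \<or> s = -1" and b: "b \<in> B" and K: "0 < K"
  shows "\<exists>!t. t \<in> B \<and> 0 < s * (t - b) \<and> breg b t = K"
proof -
  obtain u where u: "u \<in> B" "0 < s * (u - b)" "K \<le> breg b u"
    using breg_unbounded[OF b s] by blast
  then obtain t where t: "t \<in> closed_segment b u" "breg b t = K"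
    using breg_IVT[of b u K] b K by auto
  have tB: "t \<in> B" using t segment_in_B[OF b u(1)] by auto
  have "t \<noteq> b" using t K by auto
  then have side: "0 < s * (t - b)"
    using t u s by (auto simp: closed_segment_eq_real_ivl split: if_splits)
  have "t' = t" if "t' \<in> B" "0 < s * (t' - b)" "breg b t' = K" for t'
    using same_side_mono[OF s b tB that(1) side] same_side_mono[OF s b that(1) tB that(2)] that t s
    by (cases "s * t" "s * t'" rule: linorder_cases) auto
  with tB side t show ?thesis by blast
qed

lemma reach:
  assumes "s = 1 \<or> s = -1" "b \<in> B" "0 < K"
  shows "reach s K b \<in> B" "0 < s * (reach s K b - b)" "breg b (reach s K b) = K"
  using theI'[OF reach_ex1[OF assms]] unfolding reach_def by auto

lemma reach_unique:
  assumes "s = 1 \<or> s = -1" "b \<in> B" "0 < K" "t \<in> B" "0 < s * (t - b)" "breg b t = K"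
  shows "reach s K b = t"
  using reach_ex1[OF assms(1-3)] reach[OF assms(1-3)] assms(4-6) by blast

lemma
  assumes s: "s = 1 \<or> s = -1" and "b \<in> B" "0 < K" "t \<in> B" "0 < s * (t - b)"
  shows reach_less: "K < breg b t \<Longrightarrow> s * reach s K b < s * t"
    and less_reach: "breg b t < K \<Longrightarrow> s * t < s * reach s K b"
  using same_side_mono[of s b t "reach s K b"] same_side_mono[of s b "reach s K b" t]
    reach[of s b K] assms
  by (cases "s * t" "s * reach s K b" rule: linorder_cases; force)+

text \<open>
  By monotonicity the sign of \<open>breg x t - K\<close> tells on which side of \<open>t\<close> the point \<open>reach s K x\<close>
  lies, and for fixed \<open>t\<close> this sign is locally constant in \<open>x\<close>.
\<close>

lemma cont_reach:
  assumes s: "s = 1 \<or> s = -1" and K: "0 < K"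
  shows "continuous_on B (reach s K)"
proof (rule continuous_at_imp_continuous_on, rule ballI)
  fix b assume b: "b \<in> B"
  define t where "t = reach s K b"
  have t: "t \<in> B" "0 < s * (t - b)" "breg b t = K"
    using reach[OF s b K] by (auto simp: t_def)
  have ss: "s * s = 1" using s by auto
  have evB: "eventually (\<lambda>x. x \<in> B) (at b)"
    using open_B b by (rule eventually_at_in_open')
  have lim: "((\<lambda>x. breg x u) \<longlongrightarrow> breg b u) (at b)" if "u \<in> B" for u
    using cont_breg_left[OF that] b open_B
    by (simp add: continuous_on_eq_continuous_at isCont_def)
  have side: "eventually (\<lambda>x. 0 < s * (u - x)) (at b)" if "0 < s * (u - b)" for u
    using that by (intro order_tendstoD(1)[of _ "s * (u - b)"]) (auto intro!: tendsto_intros)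
  have "((\<lambda>x. s * reach s K x) \<longlongrightarrow> s * t) (at b)"
  proof (rule order_tendstoI)
    fix a assume a: "a < s * t"
    define u where "u = s * ((max a (s * b) + s * t) / 2)"
    have su: "s * u = (max a (s * b) + s * t) / 2"
      by (simp add: u_def mult.assoc[symmetric] ss)
    have lt: "a < s * u" "s * b < s * u" "s * u < s * t"
      using a t(2) unfolding su by (auto simp: algebra_simps max_def)
    have "u \<in> closed_segment b t"
      using lt s by (auto simp: closed_segment_eq_real_ivl)
    then have u: "u \<in> B" using segment_in_B[OF b t(1)] by auto
    have "breg b u < K"
      using same_side_mono[OF s b u t(1)] lt t by (simp add: algebra_simps)
    then have "eventually (\<lambda>x. breg x u < K) (at b)"
      by (rule order_tendstoD(2)[OF lim[OF u]])
    moreover have "eventually (\<lambda>x. 0 < s * (u - x)) (at b)"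
      using lt by (intro side) (simp add: algebra_simps)
    ultimately show "eventually (\<lambda>x. a < s * reach s K x) (at b)"
      using evB by eventually_elim (use less_reach[OF s _ K u] lt(1) in force)
  next
    fix a assume a: "s * t < a"
    have "eventually (\<lambda>u. u \<in> B) (at t)"
      using open_B t(1) by (rule eventually_at_in_open')
    then obtain e where e: "0 < e" "\<And>u. u \<noteq> t \<Longrightarrow> dist u t < e \<Longrightarrow> u \<in> B"
      by (auto simp: eventually_at)
    define h where "h = min (e / 2) ((a - s * t) / 2)"
    have h: "0 < h" "h < e" "s * t + h < a" using e a by (auto simp: h_def min_def field_simps)
    define u where "u = t + s * h"
    have su: "s * u = s * t + h"
      by (simp add: u_def distrib_left mult.assoc[symmetric] ss)
    have u: "u \<in> B" using h s by (intro e(2)) (auto simp: u_def dist_real_def)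
    have pos: "0 < s * (u - b)" using t(2) su h by (simp add: algebra_simps)
    have "K < breg b u"
      using same_side_mono[OF s b t(1) u] su h t by simp
    then have "eventually (\<lambda>x. K < breg x u) (at b)"
      by (rule order_tendstoD(1)[OF lim[OF u]])
    then show "eventually (\<lambda>x. s * reach s K x < a) (at b)"
      using evB side[OF pos] by eventually_elim (use reach_less[OF s _ K u] su h in force)
  qed
  then have "((\<lambda>x. s * (s * reach s K x)) \<longlongrightarrow> s * (s * t)) (at b)"
    by (rule tendsto_mult_left)
  then show "isCont (reach s K) b"
    unfolding isCont_def t_def by (simp only: mult.assoc[symmetric] ss mult_1_left)
qed

end

section \<open>Comparison of the objective with the extremal function for kappa\<close>

text \<open>Shifting both exponents by at most \<open>e\<close> changes the denominator by a factor in \<open>[exp (- e), exp e]\<close>.\<close>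

lemma hump_compare:
  assumes "\<bar>P - x\<bar> \<le> e" "\<bar>Q - x\<bar> \<le> e"
  shows "exp (- e) * hump x \<le> x\<^sup>2 / (exp P + exp (- Q))"
    and "x\<^sup>2 / (exp P + exp (- Q)) \<le> exp e * hump x"
proof -
  have "exp P \<le> exp (x + e)" "exp (- Q) \<le> exp (- x + e)"
    "exp (x - e) \<le> exp P" "exp (- x - e) \<le> exp (- Q)"
    using assms by (auto simp: abs_le_iff)
  moreover have e: "exp e * (exp x + exp (- x)) = exp (x + e) + exp (- x + e)"
    "exp (- e) * (exp x + exp (- x)) = exp (x - e) + exp (- x - e)"
    by (simp_all add: exp_add[symmetric] distrib_left algebra_simps)
  ultimately have up: "exp P + exp (- Q) \<le> exp e * (exp x + exp (- x))"
    and lo: "exp (- e) * (exp x + exp (- x)) \<le> exp P + exp (- Q)"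
    using e by linarith+
  have "x\<^sup>2 / (exp e * (exp x + exp (- x))) \<le> x\<^sup>2 / (exp P + exp (- Q))"
    using up by (intro divide_left_mono) (auto simp: add_pos_pos)
  then show "exp (- e) * hump x \<le> x\<^sup>2 / (exp P + exp (- Q))"
    by (simp add: hump_def exp_minus divide_simps)
  have "x\<^sup>2 / (exp P + exp (- Q)) \<le> x\<^sup>2 / (exp (- e) * (exp x + exp (- x)))"
    using lo by (intro divide_left_mono) (auto simp: add_pos_pos)
  then show "x\<^sup>2 / (exp P + exp (- Q)) \<le> exp e * hump x"
    by (simp add: hump_def exp_minus field_simps)
qed

lemma abs_diff_le_of_squares:
  fixes P x d :: real
  assumes "0 \<le> P" "0 \<le> x" "\<bar>P\<^sup>2 - x\<^sup>2\<bar> \<le> d * x\<^sup>2"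
  shows "\<bar>P - x\<bar> \<le> d * x"
proof (cases "x = 0")
  case False
  have "P\<^sup>2 - x\<^sup>2 = (P + x) * (P - x)"
    by (simp add: power2_eq_square algebra_simps)
  then have "(P + x) * \<bar>P - x\<bar> = \<bar>P\<^sup>2 - x\<^sup>2\<bar>"
    using assms(1,2) by (simp add: abs_mult)
  moreover have "x * \<bar>P - x\<bar> \<le> (P + x) * \<bar>P - x\<bar>"
    using assms by (intro mult_right_mono) auto
  ultimately have "x * \<bar>P - x\<bar> \<le> \<bar>P\<^sup>2 - x\<^sup>2\<bar>" by simp
  also have "\<dots> \<le> x * (d * x)" using assms(3) by (simp add: power2_eq_square ac_simps)
  finally show ?thesis using False assms(2) by (simp add: mult_le_cancel_left)
qed (use assms in auto)

lemma square_exp_tail: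
  fixes k :: real
  assumes "0 < k" "0 < v"
  obtains X where "1 \<le> X" "\<And>x. X \<le> x \<Longrightarrow> x\<^sup>2 * exp (- (k * x)) \<le> v"
proof -
  have "((\<lambda>y::real. y ^ 2 / exp y) \<longlongrightarrow> 0) at_top"
    by (rule tendsto_power_div_exp_0)
  then have "eventually (\<lambda>y::real. y\<^sup>2 / exp y < v * k\<^sup>2) at_top"
    using assms by (intro order_tendstoD(2)) auto
  then obtain Y where Y: "\<And>y::real. Y \<le> y \<Longrightarrow> y\<^sup>2 / exp y < v * k\<^sup>2"
    by (auto simp: eventually_at_top_linorder)
  show thesis
  proof (rule that[of "max 1 (Y / k)"])
    fix x assume x: "max 1 (Y / k) \<le> x"
    then have "Y \<le> k * x" using assms by (simp add: divide_le_eq mult.commute)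
    from Y[OF this] show "x\<^sup>2 * exp (- (k * x)) \<le> v"
      using assms by (simp add: exp_minus power_mult_distrib field_simps)
  qed simp
qed

context regular_cumulant
begin

text \<open>
  The number \<open>expo n K bh (\<plusminus>1) b\<close> is the log-likelihood ratio of \<open>\<theta>\<^sup>\<plusminus>\<close> against \<open>\<theta>\<close>, up to the common
  summand \<open>- n K\<close>, when \<open>\<theta>\<close> and the estimate have canonical parameters \<open>b\<close> and \<open>bh\<close>. Consequently
  \<open>objective\<close> is the product of loss and posterior, up to the factor \<open>exp (n K)\<close>.
\<close>

definition expo :: "real \<Rightarrow> real \<Rightarrow> real \<Rightarrow> real \<Rightarrow> real \<Rightarrow> real" where
  "expo n K bh s b = n * ((reach s K b - b) * (A1 bh - A1 b))"

definition objective :: "real \<Rightarrow> real \<Rightarrow> real \<Rightarrow> real \<Rightarrow> real" where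
  "objective n K bh b = 4 * breg bh b / (exp (expo n K bh 1 b) + exp (expo n K bh (-1) b))"

definition radius :: "real \<Rightarrow> real \<Rightarrow> real \<Rightarrow> real \<Rightarrow> real" where
  "radius n K bh b = 2 * n * sqrt (K * breg bh b)"

lemma radius_nonneg: "0 \<le> n \<Longrightarrow> 0 \<le> K \<Longrightarrow> bh \<in> B \<Longrightarrow> b \<in> B \<Longrightarrow> 0 \<le> radius n K bh b"
  by (simp add: radius_def breg_nonneg)

lemma radius_square:
  "0 \<le> K \<Longrightarrow> bh \<in> B \<Longrightarrow> b \<in> B \<Longrightarrow> (radius n K bh b)\<^sup>2 = 4 * n\<^sup>2 * K * breg bh b"
  by (simp add: radius_def power_mult_distrib breg_nonneg)

text \<open>
  With \<^const>\<open>radius\<close> as variable, the objective has the shape of \<^const>\<open>hump\<close> exactly, except that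
  the exponents \<open>\<plusminus> x\<close> are replaced by two numbers \<open>P\<close> and \<open>- Q\<close>; which of the two directions
  gives the positive exponent depends on the side of \<open>bh\<close> on which \<open>b\<close> lies.
\<close>

lemma objective_eq_perturbed_hump:
  assumes "0 < n" "0 < K" "bh \<in> B" "b \<in> B"
  obtains P Q s where "s = 1 \<or> s = -1" "0 \<le> P" "0 \<le> Q"
    "P = expo n K bh s b" "Q = - expo n K bh (- s) b"
    "n\<^sup>2 * K * objective n K bh b = (radius n K bh b)\<^sup>2 / (exp P + exp (- Q))"
proof -
  define s :: real where "s = (if b \<le> bh then 1 else -1)"
  have s: "s = 1 \<or> s = -1" by (simp add: s_def)
  have side: "0 \<le> s * (A1 bh - A1 b)"
    using A1_strict_mono[of b bh] A1_strict_mono[of bh b] assms(3,4)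
    by (cases b bh rule: linorder_cases) (auto simp: s_def)
  have sign: "0 \<le> r * s * expo n K bh r b" if "r = 1 \<or> r = -1" for r
  proof -
    have "r * s * expo n K bh r b = n * ((r * (reach r K b - b)) * (s * (A1 bh - A1 b)))"
      by (simp add: expo_def)
    moreover have "0 \<le> r * (reach r K b - b)"
      using reach(2)[OF that assms(4,2)] by simp
    ultimately show ?thesis
      using side assms(1) by (metis less_imp_le mult_nonneg_nonneg)
  qed
  show thesis
  proof (rule that[OF s _ _ refl refl])
    show "0 \<le> expo n K bh s b" "0 \<le> - expo n K bh (- s) b"
      using sign[of s] sign[of "-s"] s by auto
    show "n\<^sup>2 * K * objective n K bh b =
        (radius n K bh b)\<^sup>2 / (exp (expo n K bh s b) + exp (- (- expo n K bh (- s) b)))"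
      using s assms by (auto simp: objective_def radius_square add.commute mult_ac)
  qed
qed

text \<open>
  The exponent is a product of a displacement in the canonical parameter and a difference of
  means, \<^const>\<open>radius\<close> is built from two divergences. By the mean value theorem each of these is a
  power of a displacement times a value of \<open>A2\<close>, and the displacements cancel. Both the
  coarse and the fine estimate of the exponents come from this identity.
\<close>

lemma expo_square:
  assumes s: "s = 1 \<or> s = -1" and "0 < K" "bh \<in> B" "b \<in> B"
  obtains \<xi>1 \<xi>2 \<xi>3 where
    "\<xi>1 \<in> closed_segment b (reach s K b)" "\<xi>2 \<in> closed_segment bh b" "\<xi>3 \<in> closed_segment bh b"
    "(expo n K bh s b)\<^sup>2 * (A2 \<xi>1 * A2 \<xi>2) = (radius n K bh b)\<^sup>2 * (A2 \<xi>3)\<^sup>2"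
proof -
  define t where "t = reach s K b"
  have t: "t \<in> B" "breg b t = K"
    using reach[OF s assms(4,2)] by (auto simp: t_def)
  obtain \<xi>1 where 1: "\<xi>1 \<in> closed_segment b t" "K = A2 \<xi>1 / 2 * (t - b)\<^sup>2"
    using breg_mvt[OF assms(4) t(1)] t(2) by auto
  obtain \<xi>2 where 2: "\<xi>2 \<in> closed_segment bh b" "breg bh b = A2 \<xi>2 / 2 * (b - bh)\<^sup>2"
    using breg_mvt[OF assms(3,4)] by auto
  obtain \<xi>3 where 3: "\<xi>3 \<in> closed_segment bh b" "A1 b - A1 bh = A2 \<xi>3 * (b - bh)"
    using A1_mvt[OF assms(3,4)] by auto
  have "A1 bh - A1 b = - (A2 \<xi>3 * (b - bh))" using 3(2) by simp
  then have "(expo n K bh s b)\<^sup>2 = n\<^sup>2 * ((t - b)\<^sup>2 * (A2 \<xi>3 * (b - bh))\<^sup>2)"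
    by (simp add: expo_def t_def[symmetric] power_mult_distrib)
  moreover have "(radius n K bh b)\<^sup>2 = 4 * n\<^sup>2 * (A2 \<xi>1 / 2 * (t - b)\<^sup>2) * (A2 \<xi>2 / 2 * (b - bh)\<^sup>2)"
    by (simp only: radius_square[OF less_imp_le[OF assms(2)] assms(3,4)]
        1(2)[symmetric] 2(2)[symmetric])
  ultimately have "(expo n K bh s b)\<^sup>2 * (A2 \<xi>1 * A2 \<xi>2) = (radius n K bh b)\<^sup>2 * (A2 \<xi>3)\<^sup>2"
    by (simp only: power_mult_distrib) simp
  then show thesis
    by (rule that[OF 1(1)[unfolded t_def] 2(1) 3(1)])
qed

lemma objective_self [simp]: "objective n K b b = 0"
  by (simp add: objective_def)

lemma objective_nonneg: "bh \<in> B \<Longrightarrow> b \<in> B \<Longrightarrow> 0 \<le> objective n K bh b"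
  by (simp add: objective_def breg_nonneg add_nonneg_nonneg)

text \<open>One of the two exponents is nonnegative, so the denominator exceeds \<open>1\<close>.\<close>

lemma objective_le:
  assumes "0 < n" "0 < K" "bh \<in> B" "b \<in> B"
  shows "objective n K bh b \<le> 4 * breg bh b"
proof -
  obtain s where "s = 1 \<or> s = -1" "0 \<le> expo n K bh s b"
    using objective_eq_perturbed_hump[OF assms] by metis
  then have "1 \<le> exp (expo n K bh 1 b) + exp (expo n K bh (-1) b)"
    by (auto intro: add_increasing add_increasing2)
  then have "4 * breg bh b / (exp (expo n K bh 1 b) + exp (expo n K bh (-1) b)) \<le> 4 * breg bh b / 1"
    using breg_nonneg[OF assms(3,4)] by (intro divide_left_mono) auto
  then show ?thesis by (simp add: objective_def)
qed

lemma cont_objective: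
  assumes "0 < K" "bh \<in> B"
  shows "continuous_on B (objective n K bh)"
proof -
  have "continuous_on B (expo n K bh s)" if "s = 1 \<or> s = -1" for s
    unfolding expo_def by (intro continuous_intros cont_reach that assms cont_A1)
  then show ?thesis
    unfolding objective_def
    by (intro continuous_intros cont_breg_right) (auto simp: add_pos_pos less_imp_neq[symmetric])
qed

end

section \<open>Estimates uniform over a compact interval\<close>

text \<open>
  The interval \<open>{p..q}\<close> plays the role of \<open>\<Theta>\<degree>\<close> in canonical coordinates. The constants control \<open>A2\<close>
  on a slightly larger interval, because \<^const>\<open>regular_cumulant.reach\<close> may leave \<open>{p..q}\<close>.
\<close>

locale cumulant_interval = regular_cumulant +
  fixes p q \<rho> m H T c :: real
  assumes pq: "p < q" and \<rho>: "0 < \<rho>" and wide: "{p - \<rho>..q + \<rho>} \<subseteq> B"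
    and m: "0 < m" and H: "0 < H" and T: "0 \<le> T" and c: "0 < c"
    and A2_bounds: "\<And>x. x \<in> {p - \<rho>..q + \<rho>} \<Longrightarrow> m \<le> A2 x \<and> A2 x \<le> H"
    and A2_Lipschitz: "\<And>x y. x \<in> {p - \<rho>..q + \<rho>} \<Longrightarrow> y \<in> {p - \<rho>..q + \<rho>} \<Longrightarrow>
      \<bar>A2 x - A2 y\<bar> \<le> T * \<bar>x - y\<bar>"
begin

lemma J_B: "x \<in> {p..q} \<Longrightarrow> x \<in> B"
  using wide \<rho> by auto

lemma J_wide: "x \<in> {p..q} \<Longrightarrow> x \<in> {p - \<rho>..q + \<rho>}"
  using \<rho> by auto

lemma breg_bounds:
  assumes "b \<in> {p - \<rho>..q + \<rho>}" "t \<in> {p - \<rho>..q + \<rho>}"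
  shows "m / 2 * (t - b)\<^sup>2 \<le> breg b t" "breg b t \<le> H / 2 * (t - b)\<^sup>2"
proof -
  obtain \<xi> where \<xi>: "\<xi> \<in> closed_segment b t" "breg b t = A2 \<xi> / 2 * (t - b)\<^sup>2"
    using breg_mvt[of b t] assms wide by blast
  have "\<xi> \<in> {p - \<rho>..q + \<rho>}"
    using \<xi>(1) assms by (auto simp: closed_segment_eq_real_ivl split: if_splits)
  then have le: "m / 2 \<le> A2 \<xi> / 2" "A2 \<xi> / 2 \<le> H / 2"
    using A2_bounds[of \<xi>] by auto
  show "m / 2 * (t - b)\<^sup>2 \<le> breg b t" "breg b t \<le> H / 2 * (t - b)\<^sup>2"
    unfolding \<xi>(2) using le[THEN mult_right_mono, of "(t - b)\<^sup>2"] by simp_all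
qed

lemma reach_near:
  assumes s: "s = 1 \<or> s = -1" and K: "0 < K" "K < m * \<rho>\<^sup>2 / 2" and b: "b \<in> {p..q}"
  shows "reach s K b \<in> {p - \<rho>..q + \<rho>}" "(reach s K b - b)\<^sup>2 \<le> 2 * K / m"
proof -
  define t where "t = b + s * \<rho>"
  have t: "t \<in> {p - \<rho>..q + \<rho>}" using s b \<rho> by (auto simp: t_def)
  then have tB: "t \<in> B" using wide by auto
  have side: "0 < s * (t - b)" using s \<rho> by (auto simp: t_def)
  have "K < m / 2 * (t - b)\<^sup>2"
    using K s by (auto simp: t_def)
  also have "\<dots> \<le> breg b t" by (rule breg_bounds[OF J_wide[OF b] t])
  finally have "s * reach s K b < s * t"
    by (rule reach_less[OF s J_B[OF b] K(1) tB side])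
  moreover have "0 < s * (reach s K b - b)" by (rule reach[OF s J_B[OF b] K(1)])
  ultimately show r: "reach s K b \<in> {p - \<rho>..q + \<rho>}"
    using s b \<rho> by (auto simp: t_def)
  have "m / 2 * (reach s K b - b)\<^sup>2 \<le> K"
    using breg_bounds(1)[OF J_wide[OF b] r] reach(3)[OF s J_B[OF b] K(1)] by simp
  then show "(reach s K b - b)\<^sup>2 \<le> 2 * K / m" using m by (simp add: field_simps)
qed

text \<open>Far from the estimate the two-sided bounds on \<open>A2\<close> suffice.\<close>

lemma expo_coarse:
  assumes s: "s = 1 \<or> s = -1" and n: "0 < n" and K: "0 < K" "K < m * \<rho>\<^sup>2 / 2"
    and b: "b \<in> {p..q}" "bh \<in> {p..q}"
  shows "m / H * radius n K bh b \<le> \<bar>expo n K bh s b\<bar>"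
proof -
  obtain \<xi>1 \<xi>2 \<xi>3 where \<xi>:
    "\<xi>1 \<in> closed_segment b (reach s K b)" "\<xi>2 \<in> closed_segment bh b" "\<xi>3 \<in> closed_segment bh b"
    and eq: "(expo n K bh s b)\<^sup>2 * (A2 \<xi>1 * A2 \<xi>2) = (radius n K bh b)\<^sup>2 * (A2 \<xi>3)\<^sup>2"
    using expo_square[OF s K(1) J_B[OF b(2)] J_B[OF b(1)]] by metis
  have in_wide: "\<xi>1 \<in> {p - \<rho>..q + \<rho>}" "\<xi>2 \<in> {p - \<rho>..q + \<rho>}" "\<xi>3 \<in> {p - \<rho>..q + \<rho>}"
    using \<xi> J_wide[OF b(1)] J_wide[OF b(2)] reach_near(1)[OF s K b(1)]
    by (auto simp: closed_segment_eq_real_ivl split: if_splits)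
  note bnd = A2_bounds[OF in_wide(1)] A2_bounds[OF in_wide(2)] A2_bounds[OF in_wide(3)]
  have "(m * radius n K bh b)\<^sup>2 = (radius n K bh b)\<^sup>2 * m\<^sup>2" by (simp add: power_mult_distrib)
  also have "\<dots> \<le> (radius n K bh b)\<^sup>2 * (A2 \<xi>3)\<^sup>2"
    using bnd m by (intro mult_left_mono power_mono) auto
  also have "\<dots> = (expo n K bh s b)\<^sup>2 * (A2 \<xi>1 * A2 \<xi>2)" by (simp add: eq)
  also have "\<dots> \<le> (expo n K bh s b)\<^sup>2 * (H * H)"
    using bnd m H by (intro mult_left_mono mult_mono) auto
  also have "\<dots> = (H * \<bar>expo n K bh s b\<bar>)\<^sup>2" by (simp add: power_mult_distrib power2_eq_square)
  finally have "m * radius n K bh b \<le> H * \<bar>expo n K bh s b\<bar>"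
    by (rule power2_le_imp_le) (use H in simp)
  then show ?thesis using H by (simp add: field_simps)
qed

text \<open>
  Close to the estimate, all arguments of \<open>A2\<close> in the identity for the exponents are within \<open>w\<close>
  of \<open>b\<close>, and the Lipschitz bound makes the relative error of each exponent \<open>O(w)\<close>.
\<close>

lemma expo_fine:
  assumes s: "s = 1 \<or> s = -1" and n: "0 < n" and K: "0 < K" "K < m * \<rho>\<^sup>2 / 2"
    and b: "b \<in> {p..q}" "bh \<in> {p..q}"
    and w: "\<bar>b - bh\<bar> \<le> w" "\<bar>reach s K b - b\<bar> \<le> w"
  shows "\<bar>\<bar>expo n K bh s b\<bar> - radius n K bh b\<bar> \<le> 4 * H * T * w / m\<^sup>2 * radius n K bh b"
proof (rule abs_diff_le_of_squares)
  obtain \<xi>1 \<xi>2 \<xi>3 where \<xi>: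
    "\<xi>1 \<in> closed_segment b (reach s K b)" "\<xi>2 \<in> closed_segment bh b" "\<xi>3 \<in> closed_segment bh b"
    and eq: "(expo n K bh s b)\<^sup>2 * (A2 \<xi>1 * A2 \<xi>2) = (radius n K bh b)\<^sup>2 * (A2 \<xi>3)\<^sup>2"
    using expo_square[OF s K(1) J_B[OF b(2)] J_B[OF b(1)]] by metis
  have in_wide: "\<xi>1 \<in> {p - \<rho>..q + \<rho>}" "\<xi>2 \<in> {p - \<rho>..q + \<rho>}" "\<xi>3 \<in> {p - \<rho>..q + \<rho>}"
    using \<xi> J_wide[OF b(1)] J_wide[OF b(2)] reach_near(1)[OF s K b(1)]
    by (auto simp: closed_segment_eq_real_ivl split: if_splits)
  note bnd = A2_bounds[OF in_wide(1)] A2_bounds[OF in_wide(2)] A2_bounds[OF in_wide(3)]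
  have "\<bar>\<xi>1 - b\<bar> \<le> w" "\<bar>\<xi>2 - b\<bar> \<le> w" "\<bar>\<xi>3 - b\<bar> \<le> w"
    using \<xi> w by (auto simp: closed_segment_eq_real_ivl split: if_splits)
  then have "\<bar>\<xi>3 - \<xi>1\<bar> \<le> 2 * w" "\<bar>\<xi>3 - \<xi>2\<bar> \<le> 2 * w" by auto
  then have close: "\<bar>A2 \<xi>3 - A2 \<xi>1\<bar> \<le> T * (2 * w)" "\<bar>A2 \<xi>3 - A2 \<xi>2\<bar> \<le> T * (2 * w)"
    using A2_Lipschitz[OF in_wide(3) in_wide(1)] A2_Lipschitz[OF in_wide(3) in_wide(2)]
      mult_left_mono[OF _ T] by (meson order_trans)+
  define x where "x = radius n K bh b"
  define a1 a2 a3 where "a1 = A2 \<xi>1" and "a2 = A2 \<xi>2" and "a3 = A2 \<xi>3"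
  have a: "m \<le> a1" "m \<le> a2" "m \<le> a3" "a1 \<le> H" "a3 \<le> H"
    using bnd by (auto simp: a1_def a2_def a3_def)
  have "a3\<^sup>2 - a1 * a2 = a3 * (a3 - a2) + a2 * (a3 - a1)"
    by (simp add: power2_eq_square algebra_simps)
  then have "\<bar>a3\<^sup>2 - a1 * a2\<bar> \<le> \<bar>a3 * (a3 - a2)\<bar> + \<bar>a2 * (a3 - a1)\<bar>"
    by (simp only: abs_triangle_ineq)
  also have "\<dots> \<le> H * (T * (2 * w)) + H * (T * (2 * w))"
    unfolding abs_mult using bnd m close
    by (intro add_mono mult_mono) (auto simp: a1_def a2_def a3_def)
  finally have num: "\<bar>a3\<^sup>2 - a1 * a2\<bar> \<le> 4 * H * T * w" by simp
  have den: "m\<^sup>2 \<le> a1 * a2"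
    using a m by (auto simp: power2_eq_square intro!: mult_mono)
  have w0: "0 \<le> w" using w by auto
  have "(expo n K bh s b)\<^sup>2 * (a1 * a2) = x\<^sup>2 * a3\<^sup>2"
    using eq by (simp add: x_def a1_def a2_def a3_def)
  then have "((expo n K bh s b)\<^sup>2 - x\<^sup>2) * (a1 * a2) = x\<^sup>2 * (a3\<^sup>2 - a1 * a2)"
    by (simp add: algebra_simps)
  then have "\<bar>(expo n K bh s b)\<^sup>2 - x\<^sup>2\<bar> * (a1 * a2) = x\<^sup>2 * \<bar>a3\<^sup>2 - a1 * a2\<bar>"
    using den m by (metis abs_mult abs_of_nonneg order_trans zero_le_power2)
  also have "\<dots> \<le> x\<^sup>2 * (4 * H * T * w)" using num by (intro mult_left_mono) auto
  finally have "\<bar>(expo n K bh s b)\<^sup>2 - x\<^sup>2\<bar> * (a1 * a2) \<le> x\<^sup>2 * (4 * H * T * w)" .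
  moreover have "\<bar>(expo n K bh s b)\<^sup>2 - x\<^sup>2\<bar> * m\<^sup>2 \<le> \<bar>(expo n K bh s b)\<^sup>2 - x\<^sup>2\<bar> * (a1 * a2)"
    using den by (intro mult_left_mono) auto
  ultimately have "\<bar>(expo n K bh s b)\<^sup>2 - x\<^sup>2\<bar> \<le> 4 * H * T * w / m\<^sup>2 * x\<^sup>2"
    using m by (simp add: field_simps)
  then show "\<bar>\<bar>expo n K bh s b\<bar>\<^sup>2 - (radius n K bh b)\<^sup>2\<bar> \<le> 4 * H * T * w / m\<^sup>2 * (radius n K bh b)\<^sup>2"
    by (simp add: x_def)
qed (use radius_nonneg[of n K bh b] n K J_B[OF b(1)] J_B[OF b(2)] in auto)

text \<open>The condition on \<open>n\<close> and \<open>K = 1/n*\<close> under which all bounds are uniform.\<close>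

definition admissible :: "real \<Rightarrow> real \<Rightarrow> bool" where
  "admissible n K \<longleftrightarrow> 0 < n \<and> 0 < K \<and> c \<le> n * K \<and> n * K \<le> 1 / c"

lemma K_le: "admissible n K \<Longrightarrow> K \<le> 1 / (c * n)"
  using c by (auto simp: admissible_def field_simps)

definition large :: real where
  "large = 1 + 2 / (c * (m * \<rho>\<^sup>2))"

lemma large_ge_1: "1 \<le> large"
  using c m by (simp add: large_def)

lemma K_small:
  assumes "admissible n K" "large \<le> n"
  shows "K < m * \<rho>\<^sup>2 / 2"
proof -
  have pos: "0 < c * (m * \<rho>\<^sup>2)" using c m \<rho> by simp
  have "2 / (c * (m * \<rho>\<^sup>2)) < n" using assms(2) by (simp add: large_def)
  then have "2 < n * (c * (m * \<rho>\<^sup>2))" using pos by (simp add: pos_divide_less_eq)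
  then have "1 / (c * n) < m * \<rho>\<^sup>2 / 2"
    using assms(1) c by (simp add: admissible_def divide_simps mult_ac)
  with K_le[OF assms(1)] show ?thesis by simp
qed

lemma breg_le_of_radius:
  assumes "admissible n K" "b \<in> {p..q}" "bh \<in> {p..q}" "radius n K bh b \<le> X"
  shows "breg bh b \<le> X\<^sup>2 / (4 * c * n)"
proof -
  have nK: "0 < n" "0 < K" "c \<le> n * K" using assms(1) by (auto simp: admissible_def)
  have D: "0 \<le> breg bh b" by (rule breg_nonneg[OF J_B[OF assms(3)] J_B[OF assms(2)]])
  have "4 * c * n * breg bh b \<le> 4 * (n * K) * n * breg bh b"
    using nK D by (intro mult_right_mono) auto
  also have "\<dots> = (radius n K bh b)\<^sup>2"
    using radius_square[of K bh b n] nK J_B assms(2,3) by (simp add: power2_eq_square mult_ac)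
  also have "\<dots> \<le> X\<^sup>2"
    using radius_nonneg[of n K bh b] nK J_B assms by (intro power_mono) auto
  finally show ?thesis using c nK by (simp add: field_simps)
qed

text \<open>
  At bounded \<^const>\<open>radius\<close> all displacements are \<open>O(1 / sqrt n)\<close>, so the exponents differ from the
  radius by that much, and the objective from \<^const>\<open>hump\<close> by a factor \<open>exp (O(1 / sqrt n))\<close>.
\<close>

lemma objective_near:
  assumes X: "0 < X"
  obtains E N where "0 \<le> E" "large \<le> N"
    "\<And>n K b bh. N \<le> n \<Longrightarrow> admissible n K \<Longrightarrow> b \<in> {p..q} \<Longrightarrow> bh \<in> {p..q} \<Longrightarrow>
      radius n K bh b \<le> X \<Longrightarrow>
      \<bar>n\<^sup>2 * K * objective n K bh b - hump (radius n K bh b)\<bar> \<le> E / sqrt n * kappa"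
proof -
  define W where "W = sqrt (X\<^sup>2 / (2 * m * c) + 2 / (m * c))"
  define E where "E = 4 * H * T * W / m\<^sup>2"
  have W2: "W\<^sup>2 = X\<^sup>2 / (2 * m * c) + 2 / (m * c)"
    unfolding W_def using m c by (intro real_sqrt_pow2) auto
  have W0: "0 \<le> W" unfolding W_def using m c by auto
  have E0: "0 \<le> E" unfolding E_def using W0 H T by auto
  have main: "\<bar>n\<^sup>2 * K * objective n K bh b - hump (radius n K bh b)\<bar> \<le> 2 * (E * X) / sqrt n * kappa"
    if N: "max large ((E * X)\<^sup>2) \<le> n" and adm: "admissible n K"
      and b: "b \<in> {p..q}" "bh \<in> {p..q}" and x: "radius n K bh b \<le> X" for n K b bh
  proof -
    have nK: "0 < n" "0 < K" using adm by (auto simp: admissible_def)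
    have Ks: "K < m * \<rho>\<^sup>2 / 2" using K_small[OF adm] N by auto
    define x where "x = radius n K bh b"
    have x0: "0 \<le> x" "x \<le> X"
      using x radius_nonneg[of n K bh b] nK J_B b by (auto simp: x_def)
    define w where "w = W / sqrt n"
    have w0: "0 \<le> w" using W0 nK by (simp add: w_def)
    have w2: "w\<^sup>2 = X\<^sup>2 / (2 * m * c * n) + 2 / (m * c * n)"
      using nK by (simp add: w_def power_divide W2 add_divide_distrib)
    have parts: "0 \<le> X\<^sup>2 / (2 * m * c * n)" "0 \<le> 2 / (m * c * n)" using m c nK by auto
    have "m / 2 * (b - bh)\<^sup>2 \<le> X\<^sup>2 / (4 * c * n)"
      using breg_bounds(1)[OF J_wide[OF b(2)] J_wide[OF b(1)]] breg_le_of_radius[OF adm b x] by simp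
    then have "(b - bh)\<^sup>2 \<le> X\<^sup>2 / (2 * m * c * n)"
      using m c nK by (simp add: field_simps)
    then have "(b - bh)\<^sup>2 \<le> w\<^sup>2" using w2 parts by linarith
    then have t: "\<bar>b - bh\<bar> \<le> w"
      using abs_le_square_iff[of "b - bh" w] w0 by simp
    have d: "\<bar>reach s K b - b\<bar> \<le> w" if s: "s = 1 \<or> s = -1" for s
    proof -
      have "(reach s K b - b)\<^sup>2 \<le> 2 * K / m" by (rule reach_near[OF s nK(2) Ks b(1)])
      also have "\<dots> \<le> 2 / (m * c * n)"
        using K_le[OF adm] m c nK by (simp add: field_simps)
      finally have "(reach s K b - b)\<^sup>2 \<le> w\<^sup>2" using w2 parts by linarith
      then show ?thesis
        using abs_le_square_iff[of "reach s K b - b" w] w0 by simp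
    qed
    define e where "e = E * X / sqrt n"
    have e0: "0 \<le> e" using E0 X nK by (simp add: e_def)
    have "E * X \<le> sqrt n" using N E0 X by (intro real_le_rsqrt) auto
    then have e1: "e \<le> 1" using nK by (simp add: e_def)
    have close: "\<bar>\<bar>expo n K bh s b\<bar> - x\<bar> \<le> e" if s: "s = 1 \<or> s = -1" for s
    proof -
      have "\<bar>\<bar>expo n K bh s b\<bar> - x\<bar> \<le> 4 * H * T * w / m\<^sup>2 * x"
        unfolding x_def by (rule expo_fine[OF s nK(1,2) Ks b t d[OF s]])
      also have "4 * H * T * w / m\<^sup>2 = E / sqrt n" by (simp add: E_def w_def)
      also have "E / sqrt n * x \<le> E / sqrt n * X"
        using x0 E0 nK by (intro mult_left_mono) auto
      finally show ?thesis by (simp add: e_def)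
    qed
    obtain P Q s where s: "s = 1 \<or> s = -1" and PQ: "0 \<le> P" "0 \<le> Q"
      "P = expo n K bh s b" "Q = - expo n K bh (- s) b"
      and val: "n\<^sup>2 * K * objective n K bh b = (radius n K bh b)\<^sup>2 / (exp P + exp (- Q))"
      by (rule objective_eq_perturbed_hump[OF nK J_B[OF b(2)] J_B[OF b(1)]])
    have "\<bar>P - x\<bar> \<le> e" "\<bar>Q - x\<bar> \<le> e"
      using close[of s] close[of "- s"] s PQ by auto
    note cmp = hump_compare[OF this, folded val[folded x_def]]
    have "exp e \<le> 1 + 2 * e"
    proof -
      have "e\<^sup>2 \<le> e" using e0 e1 by (simp add: power2_eq_square mult_left_le)
      then show ?thesis using exp_bound[OF e0 e1] by simp
    qed
    then have "exp e * hump x \<le> (1 + 2 * e) * hump x"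
      by (rule mult_right_mono) (rule hump_nonneg)
    moreover have "(1 - e) * hump x \<le> exp (- e) * hump x"
      using exp_ge_add_one_self[of "- e"] by (intro mult_right_mono) (auto simp: hump_nonneg)
    moreover have "e * hump x \<le> e * kappa"
      using e0 by (intro mult_left_mono) (auto simp: hump_le_kappa)
    moreover have "0 \<le> e * hump x" using e0 hump_nonneg by simp
    ultimately have "\<bar>n\<^sup>2 * K * objective n K bh b - hump x\<bar> \<le> 2 * (e * kappa)"
      using cmp by (simp add: abs_le_iff algebra_simps)
    then show ?thesis by (simp add: e_def x_def)
  qed
  show thesis
    by (rule that[of "2 * (E * X)" "max large ((E * X)\<^sup>2)"]) (use main E0 X in auto)
qed

text \<open>
  At large \<^const>\<open>radius\<close> even the coarse lower bound on the positive exponent makes the objective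
  exponentially small in the radius, in particular at most \<open>kappa\<close>.
\<close>

lemma objective_far:
  obtains X where "0 < X"
    "\<And>n K b bh. large \<le> n \<Longrightarrow> admissible n K \<Longrightarrow> b \<in> {p..q} \<Longrightarrow> bh \<in> {p..q} \<Longrightarrow>
      X \<le> radius n K bh b \<Longrightarrow> n\<^sup>2 * K * objective n K bh b \<le> kappa"
proof -
  have "0 < m / H" "0 < kappa" using m H kappa_bounds by auto
  then obtain X where X: "1 \<le> X" "\<And>x. X \<le> x \<Longrightarrow> x\<^sup>2 * exp (- (m / H * x)) \<le> kappa"
    using square_exp_tail by metis
  show thesis
  proof (rule that[of X])
    fix n K b bh
    assume N: "large \<le> n" and adm: "admissible n K"
      and b: "b \<in> {p..q}" "bh \<in> {p..q}" and x: "X \<le> radius n K bh b"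
    have nK: "0 < n" "0 < K" using adm by (auto simp: admissible_def)
    have Ks: "K < m * \<rho>\<^sup>2 / 2" by (rule K_small[OF adm N])
    obtain P Q s where s: "s = 1 \<or> s = -1" and PQ: "0 \<le> P" "0 \<le> Q"
      "P = expo n K bh s b" "Q = - expo n K bh (- s) b"
      and val: "n\<^sup>2 * K * objective n K bh b = (radius n K bh b)\<^sup>2 / (exp P + exp (- Q))"
      by (rule objective_eq_perturbed_hump[OF nK J_B[OF b(2)] J_B[OF b(1)]])
    have "m / H * radius n K bh b \<le> P"
      using expo_coarse[OF s nK Ks b] PQ by simp
    then have "exp (m / H * radius n K bh b) \<le> exp P + exp (- Q)"
      by (intro add_increasing2) simp_all
    then have "(radius n K bh b)\<^sup>2 / (exp P + exp (- Q))
        \<le> (radius n K bh b)\<^sup>2 / exp (m / H * radius n K bh b)"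
      by (intro divide_left_mono) (auto simp: add_pos_pos)
    also have "\<dots> = (radius n K bh b)\<^sup>2 * exp (- (m / H * radius n K bh b))"
      by (simp add: exp_minus divide_inverse)
    also have "\<dots> \<le> kappa" by (rule X(2)[OF x])
    finally show "n\<^sup>2 * K * objective n K bh b \<le> kappa" by (simp add: val)
  qed (use X in simp)
qed

text \<open>
  The radius vanishes at the estimate and is of order \<open>sqrt n\<close> at the end of the interval farther
  from it, so it takes every fixed value once \<open>n\<close> is large. One of the two sides always has length
  at least \<open>(q - p) / 2\<close>, which is why an estimate at an endpoint does no harm.
\<close>

lemma radius_attained:
  assumes X: "0 < X"
  obtains N where "\<And>n K bh. N \<le> n \<Longrightarrow> admissible n K \<Longrightarrow> bh \<in> {p..q} \<Longrightarrow>
    \<exists>b\<in>{p..q}. radius n K bh b = X"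
proof (rule that[of "X\<^sup>2 / (4 * c * (m / 2 * ((q - p) / 2)\<^sup>2))"])
  fix n K bh
  define v0 where "v0 = m / 2 * ((q - p) / 2)\<^sup>2"
  assume N: "X\<^sup>2 / (4 * c * (m / 2 * ((q - p) / 2)\<^sup>2)) \<le> n"
    and adm: "admissible n K" and bh: "bh \<in> {p..q}"
  have nK: "0 < n" "0 < K" "c \<le> n * K" using adm by (auto simp: admissible_def)
  have v0: "0 < v0" using m pq by (simp add: v0_def)
  define u where "u = (if bh - p \<le> q - bh then q else p)"
  have u: "u \<in> {p..q}" using pq by (simp add: u_def)
  define v where "v = X\<^sup>2 / (4 * n\<^sup>2 * K)"
  have "v \<le> X\<^sup>2 / (4 * c * n)"
  proof -
    have "c * n \<le> n\<^sup>2 * K" using nK by (simp add: power2_eq_square mult_ac)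
    then show ?thesis
      unfolding v_def using c nK by (intro divide_left_mono) auto
  qed
  also have "\<dots> \<le> v0"
  proof -
    have "X\<^sup>2 / (4 * c * v0) \<le> n" using N by (simp only: v0_def)
    then show ?thesis using v0 c nK by (simp add: field_simps)
  qed
  also have "v0 \<le> m / 2 * (u - bh)\<^sup>2"
  proof -
    have "((q - p) / 2)\<^sup>2 \<le> \<bar>u - bh\<bar>\<^sup>2"
      using pq bh by (intro power_mono) (auto simp: u_def)
    then show ?thesis unfolding v0_def using m by (intro mult_left_mono) auto
  qed
  also have "\<dots> \<le> breg bh u" by (rule breg_bounds[OF J_wide[OF bh] J_wide[OF u]])
  finally have v: "v \<le> breg bh u" .
  have "0 \<le> v" using nK by (simp add: v_def)
  then obtain b where b: "b \<in> closed_segment bh u" "breg bh b = v"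
    using breg_IVT[OF J_B[OF bh] J_B[OF u] _ v] by blast
  have bJ: "b \<in> {p..q}"
    using b(1) bh u by (auto simp: closed_segment_eq_real_ivl split: if_splits)
  have "K * v = (X / (2 * n))\<^sup>2"
    using nK by (simp add: v_def power2_eq_square)
  then have "sqrt (K * v) = X / (2 * n)" using X nK by simp
  then have "radius n K bh b = X" using nK by (simp add: radius_def b(2))
  with bJ show "\<exists>b\<in>{p..q}. radius n K bh b = X" by blast
qed

text \<open>The bounds above need large \<open>n\<close>. For bounded \<open>n\<close> a bound that grows with \<open>n\<close> is good enough.\<close>

lemma objective_bounded:
  assumes adm: "admissible n K" and b: "b \<in> {p..q}" "bh \<in> {p..q}"
  shows "n\<^sup>2 * K * objective n K bh b \<le> 2 * H * (q - p)\<^sup>2 / c * n"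
proof -
  have nK: "0 < n" "0 < K" "n * K \<le> 1 / c" using adm by (auto simp: admissible_def)
  have "objective n K bh b \<le> 4 * breg bh b"
    by (rule objective_le[OF nK(1,2) J_B[OF b(2)] J_B[OF b(1)]])
  also have "\<dots> \<le> 2 * H * (b - bh)\<^sup>2"
    using breg_bounds(2)[OF J_wide[OF b(2)] J_wide[OF b(1)]] by simp
  also have "(b - bh)\<^sup>2 \<le> (q - p)\<^sup>2"
    using b by (intro abs_le_square_iff[THEN iffD1]) auto
  finally have obj: "objective n K bh b \<le> 2 * H * (q - p)\<^sup>2"
    using H by (simp add: mult_left_mono)
  have "n\<^sup>2 * K * objective n K bh b = (n * K) * (n * objective n K bh b)"
    by (simp add: power2_eq_square)
  also have "\<dots> \<le> 1 / c * (n * (2 * H * (q - p)\<^sup>2))"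
    using nK obj c objective_nonneg[OF J_B[OF b(2)] J_B[OF b(1)]]
    by (intro mult_mono mult_left_mono mult_nonneg_nonneg) auto
  finally show ?thesis by (simp add: mult_ac)
qed

lemma maximum_asymptotics:
  "\<exists>C>0. \<forall>n. 1 \<le> n \<longrightarrow> (\<forall>K. admissible n K \<longrightarrow> (\<forall>bh\<in>{p..q}.
     \<exists>f. 1 - sqrt (C / n) \<le> f \<and> f \<le> 1 + sqrt (C / n) \<and>
       is_maximum (objective n K bh) {p..q} (f * kappa / (n\<^sup>2 * K))))"
proof -
  have k: "0 < kappa" using kappa_bounds by simp
  obtain x0 where x0: "0 < x0" "hump x0 = kappa" by (rule kappa_attained)
  obtain X where X: "0 < X" and far:
    "\<And>n K b bh. large \<le> n \<Longrightarrow> admissible n K \<Longrightarrow> b \<in> {p..q} \<Longrightarrow> bh \<in> {p..q} \<Longrightarrow>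
      X \<le> radius n K bh b \<Longrightarrow> n\<^sup>2 * K * objective n K bh b \<le> kappa"
    by (rule objective_far) blast
  define X1 where "X1 = max X x0"
  have X1: "0 < X1" "X \<le> X1" "x0 \<le> X1" using X by (auto simp: X1_def)
  obtain E N1 where E: "0 \<le> E" and N1: "large \<le> N1" and near:
    "\<And>n K b bh. N1 \<le> n \<Longrightarrow> admissible n K \<Longrightarrow> b \<in> {p..q} \<Longrightarrow> bh \<in> {p..q} \<Longrightarrow>
      radius n K bh b \<le> X1 \<Longrightarrow>
      \<bar>n\<^sup>2 * K * objective n K bh b - hump (radius n K bh b)\<bar> \<le> E / sqrt n * kappa"
    using objective_near[OF X1(1)] by metis
  obtain N2 where hit: "\<And>n K bh. N2 \<le> n \<Longrightarrow> admissible n K \<Longrightarrow> bh \<in> {p..q} \<Longrightarrow>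
      \<exists>b\<in>{p..q}. radius n K bh b = x0"
    by (rule radius_attained[OF x0(1)]) blast
  define N where "N = max N1 N2"
  have N: "1 \<le> N" "large \<le> N" "N1 \<le> N" "N2 \<le> N" using N1 large_ge_1 by (auto simp: N_def)
  define G where "G = 2 * H * (q - p)\<^sup>2 / c / kappa"
  have G: "0 \<le> G" using H c k by (simp add: G_def)
  \<comment> \<open>The first summand serves \<open>n \<ge> N\<close>; for \<open>n < N\<close> the others make \<open>sqrt (C / n)\<close> at least \<open>1\<close> and
    at least the crude bound \<open>G N\<close>.\<close>
  define C where "C = E\<^sup>2 + N + G\<^sup>2 * N ^ 3"
  have GN: "0 \<le> G\<^sup>2 * N ^ 3" using N by simp
  have C: "0 < C" "E\<^sup>2 \<le> C" "N \<le> C" "G\<^sup>2 * N ^ 3 \<le> C"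
    using N(1) GN zero_le_power2[of E] unfolding C_def by linarith+
  have "\<exists>f. 1 - sqrt (C / n) \<le> f \<and> f \<le> 1 + sqrt (C / n) \<and>
      is_maximum (objective n K bh) {p..q} (f * kappa / (n\<^sup>2 * K))"
    if n: "1 \<le> n" and adm: "admissible n K" and bh: "bh \<in> {p..q}" for n K bh
  proof -
    have nK: "0 < n" "0 < K" using adm by (auto simp: admissible_def)
    have "continuous_on {p..q} (objective n K bh)"
      using J_B by (intro continuous_on_subset[OF cont_objective[OF nK(2) J_B[OF bh]]]) auto
    then obtain bm where bm: "bm \<in> {p..q}" "\<And>b. b \<in> {p..q} \<Longrightarrow> objective n K bh b \<le> objective n K bh bm"
      using continuous_attains_sup[of "{p..q}" "objective n K bh"] pq by auto
    define V where "V b = n\<^sup>2 * K * objective n K bh b" for b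
    have V: "V b \<le> V bm" if "b \<in> {p..q}" for b
      unfolding V_def using bm(2)[OF that] nK by (intro mult_left_mono) auto
    define f where "f = V bm / kappa"
    have max: "is_maximum (objective n K bh) {p..q} (f * kappa / (n\<^sup>2 * K))"
      unfolding is_maximum_def using bm nK k by (auto simp: f_def V_def)
    have "1 - sqrt (C / n) \<le> f \<and> f \<le> 1 + sqrt (C / n)"
    proof (cases "N \<le> n")
      case True
      have s: "E / sqrt n \<le> sqrt (C / n)"
        using C(2) E nK by (intro real_le_rsqrt) (simp add: power_divide divide_right_mono)
      have Es: "0 \<le> E / sqrt n" using E nK by simp
      have "V bm \<le> kappa + E / sqrt n * kappa"
      proof (cases "radius n K bh bm \<le> X1")
        case True
        then have "V bm \<le> hump (radius n K bh bm) + E / sqrt n * kappa"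
          using near[OF _ adm bm(1) bh True] \<open>N \<le> n\<close> N unfolding V_def by linarith
        with hump_le_kappa show ?thesis by (meson add_right_mono order_trans)
      next
        case False
        then have "V bm \<le> kappa"
          unfolding V_def using X1 N \<open>N \<le> n\<close> by (intro far[OF _ adm bm(1) bh]) auto
        moreover have "0 \<le> E / sqrt n * kappa" by (rule mult_nonneg_nonneg[OF Es less_imp_le[OF k]])
        ultimately show ?thesis by simp
      qed
      then have "f \<le> 1 + E / sqrt n" using k by (simp add: f_def pos_divide_le_eq distrib_right)
      moreover have "1 - E / sqrt n \<le> f"
      proof -
        obtain b where b: "b \<in> {p..q}" "radius n K bh b = x0"
          using hit[OF _ adm bh] True N by (meson order_trans)
        have "\<bar>V b - kappa\<bar> \<le> E / sqrt n * kappa"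
          using near[OF _ adm b(1) bh] True N X1 x0 b(2) unfolding V_def by auto
        then have "kappa - E / sqrt n * kappa \<le> V bm" using V[OF b(1)] by linarith
        then show ?thesis using k by (simp add: f_def le_divide_eq left_diff_distrib)
      qed
      ultimately show ?thesis using s by simp
    next
      case False
      then have nN: "n \<le> N" by simp
      have "1 \<le> C / n" using C(3) nN nK by simp
      then have "1 \<le> sqrt (C / n)" by simp
      moreover have "0 \<le> f"
        unfolding f_def V_def using nK k objective_nonneg[OF J_B[OF bh] J_B[OF bm(1)]] by simp
      moreover have "f \<le> sqrt (C / n)"
      proof -
        have "f \<le> G * n"
          using divide_right_mono[OF objective_bounded[OF adm bm(1) bh], of kappa] k
          by (simp add: f_def V_def G_def)
        also have "\<dots> \<le> sqrt (C / n)"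
        proof (rule real_le_rsqrt)
          have "(G * n)\<^sup>2 * n = G\<^sup>2 * n ^ 3" by (simp add: power2_eq_square power3_eq_cube)
          also have "\<dots> \<le> G\<^sup>2 * N ^ 3" using nN nK by (intro mult_left_mono power_mono) auto
          also have "\<dots> \<le> C" by (rule C)
          finally show "(G * n)\<^sup>2 \<le> C / n" using nK by (simp add: le_divide_eq)
        qed
        finally show ?thesis .
      qed
      ultimately show ?thesis by (intro conjI) linarith+
    qed
    with max show ?thesis by blast
  qed
  with C(1) show ?thesis by blast
qed

end

text \<open>
  Every compact interval in \<open>B\<close> admits constants as required: enlarge it a little inside \<open>B\<close> and
  use continuity of \<open>A2\<close> and \<open>A3\<close> on the enlarged interval.
\<close>

theorem (in regular_cumulant) objective_maximum:
  assumes pq: "p < q" "{p..q} \<subseteq> B" and c: "0 < c"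
  shows "\<exists>C>0. \<forall>n K. 1 \<le> n \<and> 0 < K \<and> c \<le> n * K \<and> n * K \<le> 1 / c \<longrightarrow> (\<forall>bh\<in>{p..q}.
     \<exists>f. 1 - sqrt (C / n) \<le> f \<and> f \<le> 1 + sqrt (C / n) \<and>
       is_maximum (objective n K bh) {p..q} (f * kappa / (n\<^sup>2 * K)))"
proof -
  have "p \<in> B" "q \<in> B" using pq by auto
  then obtain e1 e2 where e1: "0 < e1" "cball p e1 \<subseteq> B" and e2: "0 < e2" "cball q e2 \<subseteq> B"
    using open_contains_cball_eq[OF open_B] by metis
  define \<rho> where "\<rho> = min e1 e2"
  have \<rho>: "0 < \<rho>" using e1 e2 by (simp add: \<rho>_def)
  have "p - \<rho> \<in> B" "q + \<rho> \<in> B"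
    using e1 e2 by (auto simp: \<rho>_def subset_iff dist_real_def)
  then have wide: "{p - \<rho>..q + \<rho>} \<subseteq> B"
    using segment_in_B[of "p - \<rho>" "q + \<rho>"] pq(1) \<rho> by (simp add: closed_segment_eq_real_ivl)
  let ?J = "{p - \<rho>..q + \<rho>}"
  have ne: "?J \<noteq> {}" using pq(1) \<rho> by simp
  have c2: "continuous_on ?J A2" and c3: "continuous_on ?J (\<lambda>x. \<bar>A3 x\<bar>)"
    using wide by (auto intro!: continuous_on_subset[OF cont_A2] continuous_on_rabs
        continuous_on_subset[OF cont_A3])
  obtain l where l: "l \<in> ?J" "\<And>x. x \<in> ?J \<Longrightarrow> A2 l \<le> A2 x"
    using continuous_attains_inf[OF compact_Icc ne c2] by blast
  obtain u where u: "u \<in> ?J" "\<And>x. x \<in> ?J \<Longrightarrow> A2 x \<le> A2 u"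
    using continuous_attains_sup[OF compact_Icc ne c2] by blast
  obtain v where v: "v \<in> ?J" "\<And>x. x \<in> ?J \<Longrightarrow> \<bar>A3 x\<bar> \<le> \<bar>A3 v\<bar>"
    using continuous_attains_sup[OF compact_Icc ne c3] by blast
  have "\<bar>A2 x - A2 y\<bar> \<le> \<bar>A3 v\<bar> * \<bar>x - y\<bar>" if "x \<in> ?J" "y \<in> ?J" for x y
  proof -
    have "(A2 has_field_derivative A3 z) (at z within ?J)" if "z \<in> ?J" for z
      using deriv_A2[OF subsetD[OF wide that]] by (rule has_field_derivative_at_within)
    then show ?thesis
      using field_differentiable_bound[of ?J A2 A3 "\<bar>A3 v\<bar>" x y] v that by simp
  qed
  then interpret cumulant_interval B A A1 A2 A3 p q \<rho> "A2 l" "A2 u" "\<bar>A3 v\<bar>" c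
    using pq \<rho> wide c A2_pos l u by unfold_locales auto
  show ?thesis
    using maximum_asymptotics by (auto simp: admissible_def)
qed

section \<open>The log-partition function of a regular exponential family\<close>

lemma power_le_exp:
  fixes y :: real
  assumes "0 \<le> y"
  shows "y ^ k \<le> fact k * exp y"
proof -
  have "(\<Sum>n\<in>{k}. y ^ n /\<^sub>R fact n) \<le> (\<Sum>n. y ^ n /\<^sub>R fact n)"
    using assms by (intro sum_le_suminf summable_exp_generic) auto
  then have "y ^ k / fact k \<le> exp y" by (simp add: exp_def divide_inverse mult.commute)
  then show ?thesis by (simp add: divide_le_eq mult.commute)
qed

lemma exp_abs_le: "exp \<bar>y\<bar> \<le> exp y + exp (- y :: real)"
  by (cases "0 \<le> y") (simp_all add: add_increasing add_increasing2)

lemma exp_shift_le: "exp (b * y) * exp (r * \<bar>y\<bar>) \<le> exp ((b + r) * y) + exp ((b - r) * y)"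
  if "0 \<le> r" for b r y :: real
proof -
  have "exp (b * y) * exp (r * \<bar>y\<bar>) \<le> exp (b * y) * (exp (r * y) + exp (- (r * y)))"
    using exp_abs_le[of "r * y"] that by (intro mult_left_mono) (auto simp: abs_mult)
  also have "\<dots> = exp ((b + r) * y) + exp ((b - r) * y)"
    by (simp add: distrib_left exp_add[symmetric] algebra_simps)
  finally show ?thesis .
qed

lemma exp_remainder: "\<bar>exp y - 1 - y\<bar> \<le> y\<^sup>2 * exp \<bar>y\<bar>" for y :: real
proof -
  obtain t where t: "\<bar>t\<bar> \<le> \<bar>y\<bar>" "exp y = (\<Sum>m<2. y ^ m / fact m) + exp t / fact 2 * y ^ 2"
    using Maclaurin_exp_le[of y 2] by blast
  then have "\<bar>exp y - 1 - y\<bar> = exp t / 2 * y\<^sup>2" by (simp add: numeral_2_eq_2)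
  also have "\<dots> \<le> exp \<bar>y\<bar> * y\<^sup>2"
  proof (rule mult_right_mono)
    have "exp t \<le> exp \<bar>y\<bar>" using t(1) by simp
    then show "exp t / 2 \<le> exp \<bar>y\<bar>" using exp_gt_zero[of t] by linarith
  qed simp
  finally show ?thesis by (simp add: mult.commute)
qed

locale exp_family =
  fixes M :: "'a measure" and \<phi> :: "'a \<Rightarrow> real"
  assumes regular: "regular_exp_family M \<phi>"
begin

abbreviation B :: "real set" where "B \<equiv> natural_space M \<phi>"

definition moment :: "nat \<Rightarrow> real \<Rightarrow> real" where
  "moment k b = (\<integral>x. \<phi> x ^ k * exp (b * \<phi> x) \<partial>M)"

lemma measurable_\<phi> [measurable]: "\<phi> \<in> borel_measurable M"
  using regular by (simp add: regular_exp_family_def)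

lemma not_constant: "\<not> (AE x in M. \<phi> x = k)"
  using regular by (auto simp: regular_exp_family_def)

lemma open_B: "open B"
  using regular by (simp add: regular_exp_family_def)

lemma interval_B: "is_interval B"
  unfolding is_interval_1
proof (intro ballI allI impI, elim conjE)
  fix a c b assume ab: "a \<in> B" "c \<in> B" "a \<le> b" "b \<le> c"
  have le: "exp (b * \<phi> x) \<le> exp (a * \<phi> x) + exp (c * \<phi> x)" for x
  proof (cases "0 \<le> \<phi> x")
    case True
    then have "exp (b * \<phi> x) \<le> exp (c * \<phi> x)" using ab by (simp add: mult_right_mono)
    then show ?thesis by (simp add: add_increasing)
  next
    case False
    then have "exp (b * \<phi> x) \<le> exp (a * \<phi> x)" using ab by (simp add: mult_right_mono_neg)
    then show ?thesis by (simp add: add_increasing2)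
  qed
  have "integrable M (\<lambda>x. exp (a * \<phi> x) + exp (c * \<phi> x))"
    using ab by (auto simp: natural_space_def)
  then have "integrable M (\<lambda>x. exp (b * \<phi> x))"
  proof (rule Bochner_Integration.integrable_bound)
    show "AE x in M. norm (exp (b * \<phi> x)) \<le> norm (exp (a * \<phi> x) + exp (c * \<phi> x))"
      unfolding real_norm_def abs_exp_cancel by (intro AE_I2 order_trans[OF le abs_ge_self])
  qed simp
  then show "b \<in> B" by (simp add: natural_space_def)
qed

lemma room:
  assumes "b \<in> B"
  obtains r where "0 < r" "b + r \<in> B" "b - r \<in> B"
proof -
  obtain r where "0 < r" "cball b r \<subseteq> B"
    using open_contains_cball_eq[OF open_B] assms by blast
  then show thesis by (intro that[of r]) (auto simp: subset_iff dist_real_def)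
qed

lemma integrable_abs_moment:
  assumes "b \<in> B"
  shows "integrable M (\<lambda>x. \<bar>\<phi> x\<bar> ^ k * exp (b * \<phi> x))"
proof -
  obtain r where r: "0 < r" "b + r \<in> B" "b - r \<in> B" by (rule room[OF assms])
  define C where "C = fact k / r ^ k"
  let ?g = "\<lambda>x. C * (exp ((b + r) * \<phi> x) + exp ((b - r) * \<phi> x))"
  have C: "0 \<le> C" using r by (simp add: C_def)
  have "\<bar>\<phi> x\<bar> ^ k * exp (b * \<phi> x) \<le> ?g x" for x
  proof -
    have "\<bar>\<phi> x\<bar> ^ k \<le> C * exp (r * \<bar>\<phi> x\<bar>)"
      using power_le_exp[of "r * \<bar>\<phi> x\<bar>" k] r by (simp add: C_def field_simps)
    then have "\<bar>\<phi> x\<bar> ^ k * exp (b * \<phi> x) \<le> C * (exp (b * \<phi> x) * exp (r * \<bar>\<phi> x\<bar>))"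
      using mult_right_mono[of _ _ "exp (b * \<phi> x)"] by (simp add: mult_ac)
    also have "\<dots> \<le> ?g x"
      using C r by (intro mult_left_mono exp_shift_le) auto
    finally show ?thesis .
  qed
  then have le: "norm (\<bar>\<phi> x\<bar> ^ k * exp (b * \<phi> x)) \<le> norm (?g x)" for x
    using order_trans[OF _ abs_ge_self] by (simp add: abs_mult C)
  have "integrable M ?g" using r by (auto simp: natural_space_def)
  then show ?thesis
    by (rule Bochner_Integration.integrable_bound) (use le in auto)
qed

lemma integrable_moment: "b \<in> B \<Longrightarrow> integrable M (\<lambda>x. \<phi> x ^ k * exp (b * \<phi> x))"
  using integrable_abs_moment[of b k]
  by (rule Bochner_Integration.integrable_bound) (auto simp: abs_mult power_abs)

text \<open>
  Differentiation under the integral sign. The remainder of first order is quadratic in \<open>h\<close> with a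
  coefficient that is integrable, because \<open>b\<close> can be moved by \<open>r\<close> in both directions.
\<close>

lemma deriv_moment:
  assumes b: "b \<in> B"
  shows "(moment k has_real_derivative moment (Suc k) b) (at b)"
proof -
  obtain r where r: "0 < r" "b + r \<in> B" "b - r \<in> B" by (rule room[OF b])
  let ?g = "\<lambda>x. \<bar>\<phi> x\<bar> ^ (k + 2) * exp ((b + r) * \<phi> x) + \<bar>\<phi> x\<bar> ^ (k + 2) * exp ((b - r) * \<phi> x)"
  have g: "integrable M ?g"
    using r integrable_abs_moment by (intro Bochner_Integration.integrable_add) blast+
  define C where "C = (\<integral>x. ?g x \<partial>M)"
  have rem: "\<bar>moment k (b + h) - moment k b - h * moment (Suc k) b\<bar> \<le> h\<^sup>2 * C" if h: "\<bar>h\<bar> \<le> r" for h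
  proof -
    have bh: "b + h \<in> B"
      by (rule mem_is_interval_1_I[OF interval_B r(3,2)]) (use h in auto)
    let ?d = "\<lambda>x. \<phi> x ^ k * exp ((b + h) * \<phi> x) - \<phi> x ^ k * exp (b * \<phi> x)
      - h * (\<phi> x ^ Suc k * exp (b * \<phi> x))"
    have d: "integrable M ?d"
      by (intro Bochner_Integration.integrable_diff integrable_mult_right integrable_moment b bh)
    have "moment k (b + h) - moment k b - h * moment (Suc k) b = (\<integral>x. ?d x \<partial>M)"
      unfolding moment_def
      using integrable_moment[OF b, of k] integrable_moment[OF b, of "Suc k"] integrable_moment[OF bh, of k]
      by (simp del: power_Suc)
    then have "\<bar>moment k (b + h) - moment k b - h * moment (Suc k) b\<bar> \<le> (\<integral>x. \<bar>?d x\<bar> \<partial>M)"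
      by simp
    also have "\<dots> \<le> (\<integral>x. h\<^sup>2 * ?g x \<partial>M)"
    proof (rule integral_mono)
      fix x
      define y where "y = \<phi> x"
      have "?d x = y ^ k * exp (b * y) * (exp (h * y) - 1 - h * y)"
        by (simp add: y_def exp_add[symmetric] algebra_simps)
      then have "\<bar>?d x\<bar> = \<bar>y\<bar> ^ k * exp (b * y) * \<bar>exp (h * y) - 1 - h * y\<bar>"
        by (simp add: abs_mult power_abs)
      also have "\<dots> \<le> \<bar>y\<bar> ^ k * exp (b * y) * ((h * y)\<^sup>2 * exp (r * \<bar>y\<bar>))"
      proof -
        have "exp \<bar>h * y\<bar> \<le> exp (r * \<bar>y\<bar>)" using h by (simp add: abs_mult mult_right_mono)
        then have "(h * y)\<^sup>2 * exp \<bar>h * y\<bar> \<le> (h * y)\<^sup>2 * exp (r * \<bar>y\<bar>)" by (rule mult_left_mono) simp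
        with exp_remainder[of "h * y"] show ?thesis
          by (intro mult_left_mono) auto
      qed
      also have "\<dots> = h\<^sup>2 * (\<bar>y\<bar> ^ (k + 2) * (exp (b * y) * exp (r * \<bar>y\<bar>)))"
        by (simp add: power_mult_distrib power_add power2_eq_square mult_ac)
      also have "\<dots> \<le> h\<^sup>2 * (\<bar>y\<bar> ^ (k + 2) * (exp ((b + r) * y) + exp ((b - r) * y)))"
        using r by (intro mult_left_mono exp_shift_le) auto
      finally show "\<bar>?d x\<bar> \<le> h\<^sup>2 * ?g x" by (simp add: y_def distrib_left)
    qed (use d g in auto)
    also have "\<dots> = h\<^sup>2 * C" by (simp add: C_def)
    finally show ?thesis .
  qed
  have "((\<lambda>h. (moment k (b + h) - moment k b) / h - moment (Suc k) b) \<longlongrightarrow> 0) (at 0)"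
  proof (rule Lim_null_comparison)
    have "eventually (\<lambda>h::real. \<bar>h\<bar> < r) (at 0)"
      using r by (auto simp: eventually_at dist_real_def)
    moreover have "eventually (\<lambda>h::real. h \<noteq> 0) (at 0)"
      by (simp add: eventually_at_filter)
    ultimately show "eventually (\<lambda>h. norm ((moment k (b + h) - moment k b) / h - moment (Suc k) b)
      \<le> \<bar>h\<bar> * C) (at 0)"
    proof eventually_elim
      case (elim h)
      have "(moment k (b + h) - moment k b) / h - moment (Suc k) b
          = (moment k (b + h) - moment k b - h * moment (Suc k) b) / h"
        using elim by (simp add: diff_divide_distrib)
      then have "norm ((moment k (b + h) - moment k b) / h - moment (Suc k) b)
          = \<bar>moment k (b + h) - moment k b - h * moment (Suc k) b\<bar> / \<bar>h\<bar>"
        by (simp add: abs_divide)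
      also have "\<dots> \<le> h\<^sup>2 * C / \<bar>h\<bar>"
        using rem[of h] elim by (intro divide_right_mono) auto
      also have "\<dots> = \<bar>h\<bar> * C"
      proof -
        have "h\<^sup>2 * C = \<bar>h\<bar> * C * \<bar>h\<bar>" by (simp add: power2_eq_square)
        then show ?thesis
          using elim by (simp only: nonzero_mult_div_cancel_right abs_eq_0 not_False_eq_True)
      qed
      finally show ?case .
    qed
    show "((\<lambda>h. \<bar>h\<bar> * C) \<longlongrightarrow> 0) (at 0)"
      by (rule tendsto_eq_intros refl | simp)+
  qed
  then show ?thesis
    unfolding DERIV_def by (rule LIM_zero_cancel)
qed

lemma moment_0_pos:
  assumes "b \<in> B"
  shows "0 < moment 0 b"
proof -
  have "moment 0 b \<noteq> 0"
  proof
    assume "moment 0 b = 0"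
    then have "AE x in M. exp (b * \<phi> x) = 0"
      using assms by (subst integral_nonneg_eq_0_iff_AE[symmetric])
        (auto simp: moment_def natural_space_def)
    then have "AE x in M. \<phi> x = 0" by (rule AE_mp) simp
    with not_constant show False by blast
  qed
  moreover have "0 \<le> moment 0 b"
    unfolding moment_def by (intro integral_nonneg_AE) auto
  ultimately show ?thesis by simp
qed

lemma log_partition_eq: "log_partition M \<phi> b = ln (moment 0 b)"
  by (simp add: log_partition_def moment_def)

definition mean :: "real \<Rightarrow> real" where
  "mean b = moment 1 b / moment 0 b"

definition var :: "real \<Rightarrow> real" where
  "var b = moment 2 b / moment 0 b - (mean b)\<^sup>2"

definition var_deriv :: "real \<Rightarrow> real" where
  "var_deriv b = (moment 3 b * moment 0 b - moment 2 b * moment 1 b) / (moment 0 b)\<^sup>2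
     - 2 * mean b * var b"

lemma deriv_log_partition: "b \<in> B \<Longrightarrow> (log_partition M \<phi> has_real_derivative mean b) (at b)"
  unfolding log_partition_eq[abs_def] mean_def
  using moment_0_pos[of b] deriv_moment[of b 0]
  by (auto intro!: derivative_eq_intros)

lemma deriv_mean: "b \<in> B \<Longrightarrow> (mean has_real_derivative var b) (at b)"
  unfolding mean_def[abs_def] var_def
  using moment_0_pos[of b] deriv_moment[of b 0] deriv_moment[of b 1]
  by (auto intro!: derivative_eq_intros simp: field_simps power2_eq_square numeral_2_eq_2)

lemma deriv_var:
  assumes b: "b \<in> B"
  shows "(var has_real_derivative var_deriv b) (at b)"
proof -
  have "((\<lambda>b. moment 2 b / moment 0 b) has_real_derivative
      (moment 3 b * moment 0 b - moment 2 b * moment 1 b) / (moment 0 b)\<^sup>2) (at b)"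
    using moment_0_pos[OF b] deriv_moment[OF b, of 0] deriv_moment[OF b, of 2]
    by (auto intro!: derivative_eq_intros simp: power2_eq_square numeral_3_eq_3 numeral_2_eq_2)
  moreover have "((\<lambda>b. (mean b)\<^sup>2) has_real_derivative 2 * mean b * var b) (at b)"
    using deriv_mean[OF b] by (auto intro!: derivative_eq_intros)
  ultimately show ?thesis
    unfolding var_def[abs_def] var_deriv_def by (rule DERIV_diff[folded var_def])
qed

lemma cont_moment: "continuous_on B (moment k)"
  using deriv_moment by (auto intro: continuous_at_imp_continuous_on DERIV_isCont)

lemma cont_var_deriv: "continuous_on B var_deriv"
  unfolding var_deriv_def[abs_def] var_def mean_def using moment_0_pos
  by (auto intro!: continuous_intros cont_moment simp: less_imp_neq[symmetric])

text \<open>If the variance vanished, \<open>\<phi>\<close> would be constant almost everywhere.\<close>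

lemma var_pos:
  assumes b: "b \<in> B"
  shows "0 < var b"
proof -
  define \<mu> where "\<mu> = mean b"
  let ?v = "\<lambda>x. (\<phi> x - \<mu>)\<^sup>2 * exp (b * \<phi> x)"
  have m1: "moment 1 b = \<mu> * moment 0 b"
    using moment_0_pos[OF b] by (simp add: \<mu>_def mean_def)
  note int = integrable_moment[OF b, of 0] integrable_moment[OF b, of 1] integrable_moment[OF b, of 2]
  have eq: "?v = (\<lambda>x. \<phi> x ^ 2 * exp (b * \<phi> x) - 2 * \<mu> * (\<phi> x ^ 1 * exp (b * \<phi> x))
      + \<mu>\<^sup>2 * (\<phi> x ^ 0 * exp (b * \<phi> x)))"
    by (auto simp: power2_eq_square algebra_simps)
  have intv: "integrable M ?v"
    unfolding eq using int
    by (intro Bochner_Integration.integrable_add Bochner_Integration.integrable_diff integrable_mult_right)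
  have "(\<integral>x. ?v x \<partial>M) = moment 2 b - 2 * \<mu> * moment 1 b + \<mu>\<^sup>2 * moment 0 b"
    unfolding eq moment_def using int
    by (subst Bochner_Integration.integral_add, simp, simp,
        subst Bochner_Integration.integral_diff, simp_all)
  also have "\<dots> = moment 0 b * var b"
    using moment_0_pos[OF b] m1 by (simp add: var_def \<mu>_def[symmetric] field_simps power2_eq_square)
  finally have val: "(\<integral>x. ?v x \<partial>M) = moment 0 b * var b" .
  have "(\<integral>x. ?v x \<partial>M) \<noteq> 0"
  proof
    assume "(\<integral>x. ?v x \<partial>M) = 0"
    then have "AE x in M. ?v x = 0"
      using intv by (subst integral_nonneg_eq_0_iff_AE[symmetric]) auto
    then have "AE x in M. \<phi> x = \<mu>" by (rule AE_mp) simp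
    with not_constant show False by blast
  qed
  moreover have "0 \<le> (\<integral>x. ?v x \<partial>M)" by (intro integral_nonneg_AE) auto
  ultimately show ?thesis
    using val moment_0_pos[OF b] by (metis less_le mult_eq_0_iff zero_le_mult_iff not_le)
qed

text \<open>
  By Fatou's lemma the partition function is finite at every limit of parameters along which it
  is bounded. This is where it matters that the parameter space is the full natural one.
\<close>

lemma log_partition_proper:
  assumes t: "\<And>k. t k \<in> B" and lim: "t \<longlonglongrightarrow> e" and le: "\<And>k. log_partition M \<phi> (t k) \<le> K"
  shows "e \<in> B"
proof -
  have bound: "(\<integral>\<^sup>+x. ennreal (exp (t k * \<phi> x)) \<partial>M) \<le> ennreal (exp K)" for k
  proof -
    have "moment 0 (t k) \<le> exp K"
      using le[of k] moment_0_pos[OF t[of k]] unfolding log_partition_eq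
      by (metis exp_le_cancel_iff exp_ln)
    moreover have "(\<integral>\<^sup>+x. ennreal (exp (t k * \<phi> x)) \<partial>M) = ennreal (moment 0 (t k))"
      using t[of k] by (subst nn_integral_eq_integral) (auto simp: natural_space_def moment_def)
    ultimately show ?thesis by (simp add: ennreal_leI)
  qed
  have "(\<lambda>k. ennreal (exp (t k * \<phi> x))) \<longlonglongrightarrow> ennreal (exp (e * \<phi> x))" for x
    by (intro tendsto_intros lim)
  note liminf = lim_imp_Liminf[OF sequentially_bot this]
  have "(\<integral>\<^sup>+x. ennreal (exp (e * \<phi> x)) \<partial>M)
      = (\<integral>\<^sup>+x. liminf (\<lambda>k. ennreal (exp (t k * \<phi> x))) \<partial>M)"
    by (intro nn_integral_cong) (rule liminf[symmetric])
  also have "\<dots> \<le> liminf (\<lambda>k. \<integral>\<^sup>+x. ennreal (exp (t k * \<phi> x)) \<partial>M)"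
    by (rule nn_integral_liminf) simp
  also have "\<dots> \<le> ennreal (exp K)"
    by (intro Liminf_le) (auto simp: bound)
  also have "\<dots> < \<infinity>" by simp
  finally have "(\<integral>\<^sup>+x. ennreal (exp (e * \<phi> x)) \<partial>M) < \<infinity>" .
  then show ?thesis
    unfolding natural_space_def by (auto intro!: integrableI_nonneg)
qed

sublocale regular_cumulant B "log_partition M \<phi>" mean var var_deriv
  by unfold_locales
    (use open_B interval_B deriv_log_partition deriv_mean deriv_var cont_var_deriv var_pos
      log_partition_proper in blast)+

end

section \<open>The family in canonical coordinates\<close>

context exp_family
begin

lemma exp_log_partition: "b \<in> B \<Longrightarrow> exp (log_partition M \<phi> b) = moment 0 b"
  using moment_0_pos by (simp add: log_partition_eq)

lemma canonical_density_eq: "b \<in> B \<Longrightarrow> canonical_density M \<phi> b x = exp (b * \<phi> x) / moment 0 b"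
  by (simp add: canonical_density_def exp_diff exp_log_partition)

lemma canonical_density_pos: "0 < canonical_density M \<phi> b x"
  by (simp add: canonical_density_def)

lemma measurable_canonical_density [measurable]:
  "canonical_density M \<phi> b \<in> borel_measurable M"
  unfolding canonical_density_def[abs_def] by measurable

lemma
  assumes b: "b \<in> B"
  shows integrable_canonical_density: "integrable M (canonical_density M \<phi> b)"
    and integral_canonical_density: "(\<integral>x. canonical_density M \<phi> b x \<partial>M) = 1"
    and integrable_density_\<phi>: "integrable M (\<lambda>x. canonical_density M \<phi> b x * \<phi> x)"
    and integral_density_\<phi>: "(\<integral>x. canonical_density M \<phi> b x * \<phi> x \<partial>M) = mean b"
proof -
  note int = integrable_moment[OF b, of 0] integrable_moment[OF b, of 1]
  have eq: "canonical_density M \<phi> b = (\<lambda>x. (\<phi> x ^ 0 * exp (b * \<phi> x)) / moment 0 b)"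
    "(\<lambda>x. canonical_density M \<phi> b x * \<phi> x) = (\<lambda>x. (\<phi> x ^ 1 * exp (b * \<phi> x)) / moment 0 b)"
    by (auto simp: canonical_density_eq[OF b])
  show "integrable M (canonical_density M \<phi> b)"
    unfolding eq(1) by (intro integrable_divide int)
  show "integrable M (\<lambda>x. canonical_density M \<phi> b x * \<phi> x)"
    unfolding eq(2) by (intro integrable_divide int)
  have "(\<integral>x. canonical_density M \<phi> b x \<partial>M) = moment 0 b / moment 0 b"
    by (simp add: canonical_density_eq[OF b] moment_def)
  then show "(\<integral>x. canonical_density M \<phi> b x \<partial>M) = 1" using moment_0_pos[OF b] by simp
  show "(\<integral>x. canonical_density M \<phi> b x * \<phi> x \<partial>M) = mean b"
    unfolding eq(2) mean_def by (simp add: moment_def)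
qed

lemma mean_value_eq: "b \<in> B \<Longrightarrow> mean_value M \<phi> b = mean b"
  unfolding mean_value_def canonical_measure_def
  by (subst integral_density) (auto simp: integral_density_\<phi> less_imp_le[OF canonical_density_pos])

lemma canonical_param_mean:
  assumes b: "b \<in> B"
  shows "canonical_param M \<phi> (mean b) = b"
proof -
  have "inj_on (mean_value M \<phi>) B"
    by (intro inj_onI) (metis A1_strict_mono less_irrefl linorder_neqE mean_value_eq)
  from the_inv_into_f_f[OF this b] show ?thesis
    by (simp add: canonical_param_def mean_value_eq[OF b])
qed

lemma mean_space_eq: "mean_space M \<phi> = mean ` B"
  unfolding mean_space_def by (intro image_cong) (auto simp: mean_value_eq)

lemma mean_less_iff: "b \<in> B \<Longrightarrow> t \<in> B \<Longrightarrow> mean b < mean t \<longleftrightarrow> b < t"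
  using A1_strict_mono[of b t] A1_strict_mono[of t b]
  by (cases b t rule: linorder_cases) auto

lemma mv_density_mean: "b \<in> B \<Longrightarrow> mv_density M \<phi> (mean b) = canonical_density M \<phi> b"
  by (simp add: mv_density_def canonical_param_mean)

text \<open>
  \<open>M\<close> is recovered from a member of the family, which is finite, by a finite density.
\<close>

lemma sigma_finite: "sigma_finite_measure M"
proof -
  obtain b where b: "b \<in> B" using regular by (auto simp: regular_exp_family_def)
  define N where "N = density M (\<lambda>x. ennreal (canonical_density M \<phi> b x))"
  have "emeasure N (space N) = (\<integral>\<^sup>+x. ennreal (canonical_density M \<phi> b x) \<partial>M)"
    by (simp add: N_def emeasure_density cong: nn_integral_cong)
  also have "\<dots> = 1"
    using nn_integral_eq_integral[OF integrable_canonical_density[OF b]]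
    by (simp add: integral_canonical_density[OF b] less_imp_le[OF canonical_density_pos])
  finally interpret N: finite_measure N by (intro finite_measureI) simp
  have "density N (\<lambda>x. ennreal (1 / canonical_density M \<phi> b x)) = density M (\<lambda>x. 1)"
    unfolding N_def
    by (subst density_density_eq)
      (auto simp: ennreal_mult[symmetric] less_imp_le[OF canonical_density_pos]
        less_imp_neq[OF canonical_density_pos, symmetric])
  moreover have "sigma_finite_measure (density N (\<lambda>x. ennreal (1 / canonical_density M \<phi> b x)))"
    by (subst N.sigma_finite_iff_density_finite) (simp_all add: N_def)
  ultimately show ?thesis by (simp add: density_1)
qed

lemma fam_KL_mean:
  assumes b: "b \<in> B" and t: "t \<in> B"
  shows "fam_KL M \<phi> (mean b) (mean t) = breg b t"
proof -
  interpret sigma_finite_measure M by (rule sigma_finite)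
  let ?d = "canonical_density M \<phi>" and ?A = "log_partition M \<phi>"
  have "fam_KL M \<phi> (mean b) (mean t) = (\<integral>x. ?d b x * log (exp 1) (?d b x / ?d t x) \<partial>M)"
    unfolding fam_KL_def mv_measure_def mv_density_mean[OF b] mv_density_mean[OF t]
    by (intro KL_density_density)
      (auto simp: less_imp_le[OF canonical_density_pos] less_imp_neq[OF canonical_density_pos, symmetric])
  also have "\<dots> = (\<integral>x. (b - t) * (?d b x * \<phi> x) + (?A t - ?A b) * ?d b x \<partial>M)"
  proof (intro Bochner_Integration.integral_cong refl)
    fix x
    have "?d b x / ?d t x = exp ((b - t) * \<phi> x + (?A t - ?A b))"
      by (simp add: canonical_density_def exp_diff[symmetric] algebra_simps)
    then show "?d b x * log (exp 1) (?d b x / ?d t x) = (b - t) * (?d b x * \<phi> x) + (?A t - ?A b) * ?d b x"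
      by (simp add: log_def algebra_simps)
  qed
  also have "\<dots> = (b - t) * mean b + (?A t - ?A b)"
    using integrable_canonical_density[OF b] integrable_density_\<phi>[OF b]
    by (simp add: integral_canonical_density[OF b] integral_density_\<phi>[OF b])
  finally show ?thesis by (simp add: breg_def algebra_simps)
qed

lemma
  assumes b: "b \<in> B" and n: "0 < nstar"
  shows theta_plus_mean: "theta_plus M \<phi> nstar (mean b) = mean (reach 1 (1 / nstar) b)"
    and theta_minus_mean: "theta_minus M \<phi> nstar (mean b) = mean (reach (-1) (1 / nstar) b)"
proof -
  have K: "0 < 1 / nstar" using n by simp
  have r: "reach s (1 / nstar) b \<in> B" "0 < s * (reach s (1 / nstar) b - b)"
    "breg b (reach s (1 / nstar) b) = 1 / nstar" if "s = 1 \<or> s = -1" for s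
    using reach[OF that b K] by auto
  have u: "reach s (1 / nstar) b = t"
    if "s = 1 \<or> s = -1" "t \<in> B" "0 < s * (t - b)" "breg b t = 1 / nstar" for s t
    using reach_unique[OF that(1) b K that(2-4)] .
  show "theta_plus M \<phi> nstar (mean b) = mean (reach 1 (1 / nstar) b)"
    unfolding theta_plus_def
  proof (rule the_equality)
    show "mean (reach 1 (1 / nstar) b) \<in> mean_space M \<phi> \<and> mean b < mean (reach 1 (1 / nstar) b) \<and>
        fam_KL M \<phi> (mean b) (mean (reach 1 (1 / nstar) b)) = 1 / nstar"
      using r[of 1] b by (simp add: mean_space_eq mean_less_iff fam_KL_mean)
  next
    fix x assume x: "x \<in> mean_space M \<phi> \<and> mean b < x \<and> fam_KL M \<phi> (mean b) x = 1 / nstar"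
    then obtain t where "t \<in> B" "x = mean t" by (auto simp: mean_space_eq)
    with x u[of 1 t] b show "x = mean (reach 1 (1 / nstar) b)"
      by (simp add: mean_less_iff fam_KL_mean)
  qed
  show "theta_minus M \<phi> nstar (mean b) = mean (reach (-1) (1 / nstar) b)"
    unfolding theta_minus_def
  proof (rule the_equality)
    show "mean (reach (-1) (1 / nstar) b) \<in> mean_space M \<phi> \<and> mean (reach (-1) (1 / nstar) b) < mean b \<and>
        fam_KL M \<phi> (mean b) (mean (reach (-1) (1 / nstar) b)) = 1 / nstar"
      using r[of "-1"] b by (simp add: mean_space_eq mean_less_iff fam_KL_mean)
  next
    fix x assume x: "x \<in> mean_space M \<phi> \<and> x < mean b \<and> fam_KL M \<phi> (mean b) x = 1 / nstar"
    then obtain t where "t \<in> B" "x = mean t" by (auto simp: mean_space_eq)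
    with x u[of "-1" t] b show "x = mean (reach (-1) (1 / nstar) b)"
      by (simp add: mean_less_iff fam_KL_mean)
  qed
qed

lemma seq_density_mean:
  assumes "b \<in> B"
  shows "seq_density M \<phi> n (mean b) xs = exp (b * (\<Sum>i<n. \<phi> (xs i)) - n * log_partition M \<phi> b)"
  unfolding seq_density_def mv_density_mean[OF assms] canonical_density_def
  by (simp add: exp_sum[symmetric] sum_subtractf sum_distrib_left)

text \<open>The log-likelihood is stationary at an interior maximum, which is the moment equation.\<close>

lemma is_mle_mean:
  assumes b: "b \<in> B" and mle: "is_mle M \<phi> n xs (mean b)"
  shows "(\<Sum>i<n. \<phi> (xs i)) = n * mean b"
proof -
  define s where "s = (\<Sum>i<n. \<phi> (xs i))"
  define l where "l t = t * s - n * log_partition M \<phi> t" for t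
  have le: "l t \<le> l b" if "t \<in> B" for t
  proof -
    have "\<not> seq_density M \<phi> n (mean b) xs < seq_density M \<phi> n (mean t) xs"
      using mle that by (auto simp: is_mle_def is_arg_max_def mean_space_eq)
    then show ?thesis by (simp add: seq_density_mean b that l_def s_def)
  qed
  have "(l has_real_derivative s - n * mean b) (at b)"
    unfolding l_def using deriv_log_partition[OF b] by (auto intro!: derivative_eq_intros)
  moreover obtain d where "0 < d" "cball b d \<subseteq> B"
    using open_contains_cball_eq[OF open_B] b by blast
  ultimately have "s - n * mean b = 0"
    by (intro DERIV_local_max[of l _ b d]) (auto intro!: le simp: subset_iff dist_real_def)
  then show ?thesis by (simp add: s_def)
qed

text \<open>
  With the sample mean replaced by the mean at \<open>bh\<close>, the log-likelihood ratio of a point against \<open>b\<close> is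
  linear in the displacement of the means up to the divergence between the two points, and that
  divergence is the same number \<open>1/n*\<close> for \<open>\<theta>\<^sup>+\<close> and \<open>\<theta>\<^sup>-\<close>.
\<close>

lemma loss_P_bar:
  assumes b: "b \<in> B" and bh: "bh \<in> B" and n: "0 < nstar" and mle: "is_mle M \<phi> n xs (mean bh)"
  shows "loss M \<phi> (mean b) (mean bh) * P_bar M \<phi> n nstar (mean b) xs
    = exp (n / nstar) * objective n (1 / nstar) bh b"
proof -
  define K where "K = 1 / nstar"
  have K: "0 < K" using n by (simp add: K_def)
  let ?A = "log_partition M \<phi>"
  define d where "d t = seq_density M \<phi> n (mean t) xs" for t
  have ratio: "d (reach s K b) / d b = exp (- (n * K)) * exp (expo n K bh s b)" if "s = 1 \<or> s = -1" for s
  proof -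
    have t: "reach s K b \<in> B" "breg b (reach s K b) = K" using reach[OF that b K] by auto
    have "d (reach s K b) / d b = exp (n * ((reach s K b - b) * mean bh - (?A (reach s K b) - ?A b)))"
      by (simp add: d_def seq_density_mean t b is_mle_mean[OF bh mle] exp_diff[symmetric] algebra_simps)
    also have "(reach s K b - b) * mean bh - (?A (reach s K b) - ?A b)
        = (reach s K b - b) * (mean bh - mean b) - K"
      using t(2) by (simp add: breg_def algebra_simps)
    finally show ?thesis
      by (simp add: expo_def exp_add[symmetric] algebra_simps)
  qed
  have "S_stat M \<phi> n nstar (mean b) xs = (d (reach (-1) K b) / d b + d (reach 1 K b) / d b) / 2"
    unfolding S_stat_def theta_plus_mean[OF b n] theta_minus_mean[OF b n]
    by (simp add: d_def K_def add_divide_distrib)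
  also have "\<dots> = exp (- (n * K)) * (exp (expo n K bh 1 b) + exp (expo n K bh (-1) b)) / 2"
    by (simp only: ratio simp_thms) (simp add: algebra_simps)
  finally have "P_bar M \<phi> n nstar (mean b) xs
      = 1 / (exp (- (n * K)) * (exp (expo n K bh 1 b) + exp (expo n K bh (-1) b)) / 2)"
    by (simp only: P_bar_def)
  then have "P_bar M \<phi> n nstar (mean b) xs
      = exp (n * K) * (2 / (exp (expo n K bh 1 b) + exp (expo n K bh (-1) b)))"
    by (simp add: exp_minus divide_simps)
  then show ?thesis
    by (simp add: loss_def fam_KL_mean[OF bh b] objective_def K_def)
qed

lemma mean_interval:
  assumes "a < b" "{a..b} \<subseteq> mean_space M \<phi>"
  obtains p q where "p < q" "{p..q} \<subseteq> B" "mean ` {p..q} = {a..b}"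
proof -
  have "a \<in> mean ` B" "b \<in> mean ` B" using assms unfolding mean_space_eq by auto
  then obtain p q where p: "p \<in> B" "mean p = a" and q: "q \<in> B" "mean q = b" by blast
  have pq: "p < q" using assms(1) p q by (auto simp: mean_less_iff[symmetric])
  have sub: "{p..q} \<subseteq> B"
    using segment_in_B[OF p(1) q(1)] pq by (simp add: closed_segment_eq_real_ivl)
  have "mean ` {p..q} = {a..b}"
  proof (intro set_eqI iffI)
    fix x assume "x \<in> mean ` {p..q}"
    then obtain t where t: "t \<in> {p..q}" "x = mean t" by auto
    then have "t \<in> B" using sub by auto
    then show "x \<in> {a..b}"
      using mean_less_iff[of t p] mean_less_iff[of q t] t p q by fastforce
  next
    fix x assume x: "x \<in> {a..b}"
    then obtain t where t: "t \<in> B" "x = mean t" using assms(2) by (auto simp: mean_space_eq)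
    then have "t \<in> {p..q}"
      using mean_less_iff[of t p] mean_less_iff[of q t] x p q by fastforce
    then show "x \<in> mean ` {p..q}" using t by auto
  qed
  with that pq sub show thesis by blast
qed

end

lemma is_maximum_reparam:
  assumes "is_maximum g A v" "0 \<le> k" "h ` A = D" "\<And>x. x \<in> A \<Longrightarrow> f (h x) = k * g x"
  shows "is_maximum f D (k * v)"
  using assms unfolding is_maximum_def by (auto intro!: mult_left_mono simp: image_iff)

lemma exp_1_kappa: "\<bar>exp 1 * kappa - 1.45\<bar> \<le> 0.005"
proof -
  have "exp 1 * kappa \<le> 2.7183 * 0.535"
    using exp_1_bounds kappa_bounds by (intro mult_mono) auto
  then show ?thesis using kappa_bounds(3) by (intro abs_leI) simp_all
qed

theorem theorem1:
  fixes M :: "'a measure" and \<phi> :: "'a \<Rightarrow> real" and a b :: real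
  assumes "regular_exp_family M \<phi>"
    and "a < b" and "{a..b} \<subseteq> mean_space M \<phi>"
  shows "is_maximum (\<lambda>x::real. x\<^sup>2 / (exp x + exp (- x))) UNIV kappa
    \<and> 0.53 \<le> kappa \<and> kappa < 0.54
    \<and> \<bar>exp 1 * kappa - 1.45\<bar> \<le> 0.005
    \<and> (\<forall>c::real. 0 < c \<and> c \<le> 1 \<longrightarrow>
        (\<exists>C>0. \<forall>(n::nat) (nstar::real).
           0 < n \<and> 0 < nstar \<and> c \<le> nstar / real n \<and> nstar / real n \<le> 1 / c \<longrightarrow>
           (\<forall>xs \<in> {..<n} \<rightarrow>\<^sub>E space M. \<forall>\<theta>hat \<in> {a..b}. is_mle M \<phi> n xs \<theta>hat \<longrightarrow>
              (\<exists>f. 1 - sqrt (C / real n) \<le> f \<and> f \<le> 1 + sqrt (C / real n)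
                 \<and> is_maximum (\<lambda>\<theta>. loss M \<phi> \<theta> \<theta>hat * P_bar M \<phi> n nstar \<theta> xs) {a..b}
                     (1 / real n * (nstar / real n) * exp (real n / nstar) * f * kappa)
                 \<and> (nstar = real n \<longrightarrow>
                     1 / real n * (nstar / real n) * exp (real n / nstar) * f * kappa
                     = 1 / real n * f * (exp 1 * kappa))))))"
proof (intro conjI allI impI, goal_cases)
  case 1
  show ?case using is_maximum_hump by (simp add: hump_def[abs_def])
next
  case (5 c)
  then have c: "0 < c" by simp
  interpret exp_family M \<phi> by unfold_locales (rule assms(1))
  obtain p q where pq: "p < q" "{p..q} \<subseteq> B" and img: "mean ` {p..q} = {a..b}"
    by (rule mean_interval[OF assms(2,3)])
  obtain C where C: "0 < C" and max: "\<And>n K bh. 1 \<le> n \<Longrightarrow> 0 < K \<Longrightarrow> c \<le> n * K \<Longrightarrow> n * K \<le> 1 / c \<Longrightarrow>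
      bh \<in> {p..q} \<Longrightarrow> \<exists>f. 1 - sqrt (C / n) \<le> f \<and> f \<le> 1 + sqrt (C / n) \<and>
        is_maximum (objective n K bh) {p..q} (f * kappa / (n\<^sup>2 * K))"
    using objective_maximum[OF pq c] by blast
  show ?case
  proof (rule exI[of _ C], intro conjI C allI impI ballI, goal_cases)
    case (1 n nstar xs \<theta>hat)
    then have n: "0 < real n" "1 \<le> real n" and nstar: "0 < nstar" by auto
    \<comment> \<open>The condition on \<open>n* / n\<close> is invariant under inversion.\<close>
    have ratio: "c \<le> real n * (1 / nstar)" "real n * (1 / nstar) \<le> 1 / c"
      using 1 n nstar c by (simp_all add: field_simps)
    obtain bh where bh: "bh \<in> {p..q}" "\<theta>hat = mean bh" using 1 img by blast
    obtain f where f: "1 - sqrt (C / real n) \<le> f" "f \<le> 1 + sqrt (C / real n)"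
      and fmax: "is_maximum (objective n (1 / nstar) bh) {p..q} (f * kappa / ((real n)\<^sup>2 * (1 / nstar)))"
      using max[OF n(2) _ ratio bh(1)] nstar by auto
    have "is_maximum (\<lambda>\<theta>. loss M \<phi> \<theta> \<theta>hat * P_bar M \<phi> n nstar \<theta> xs) {a..b}
        (exp (real n / nstar) * (f * kappa / ((real n)\<^sup>2 * (1 / nstar))))"
      using pq(2) bh 1 nstar
      by (intro is_maximum_reparam[OF fmax _ img]) (auto intro!: loss_P_bar)
    also have "exp (real n / nstar) * (f * kappa / ((real n)\<^sup>2 * (1 / nstar)))
        = 1 / real n * (nstar / real n) * exp (real n / nstar) * f * kappa"
      using n nstar by (simp add: field_simps power2_eq_square)
    finally have "is_maximum (\<lambda>\<theta>. loss M \<phi> \<theta> \<theta>hat * P_bar M \<phi> n nstar \<theta> xs) {a..b}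
        (1 / real n * (nstar / real n) * exp (real n / nstar) * f * kappa)" .
    then show ?case using n by (intro exI[of _ f] conjI f impI) simp_all
  qed
qed (use kappa_bounds exp_1_kappa in simp_all)

end
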